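(* Let $N=\{1,\dots,n\}$ be a finite set of agents, $A$ a non-empty finite set of objects, $a_0$ the outside option, and $\succ_A=(\succ_a)_{a\in A}$ a priority structure. On the domain $\mathbb{L}^n(A\cup\{a_0\})$ of all preference profiles, the FPTTC rule $T^{\succ_A}$ is SOSP-implementable if and only if it is a serial dictatorship.
   Context: **Setting.** $N=\{1,\dots,n\}$ is a finite set of agents, $A$ a non-empty finite set of objects, and $a_0\notin A$ the outside option. An allocation is a function $\mu:N\to A\cup\{a_0\}$ with $|\mu^{-1}(a)|\le 1$ for all $a\in A$; $\mathcal{M}$ is the set of allocations. For a finite set $X$, $\mathbb{L}(X)$ is the set of strict linear orders on $X$; a preference is an element $P$ of $\mathbb{L}(A\cup\{a_0\})$, with weak part $R$ ($x\,R\,y$ iff $x\,P\,y$ or $x=y$). A domain is a product $\mathcal{P}_N=\prod_{i\in N}\mathcal{P}_i$ with $\mathcal{P}_i\subseteq\mathbb{L}(A\cup\{a_0\})$; an assignment rule is a function $f:\mathcal{P}_N\to\mathcal{M}$, and $f_i(P_N)$ is agent $i$'s assignment. Object $a$ is acceptable to $i$ if $a\,P_i\,a_0$. A priority structure is a collection $\succ_A=(\succ_a)_{a\in A}$ with $\succ_a\in\mathbb{L}(N)$; $\tau(\succ,N')$ is the $\succ$-maximal agent in $N'\subseteq N$. **FPTTC rule.** The fixed priority top trading cycles (FPTTC) rule $T^{\succ_A}$ associated with $\succ_A$ is computed at a profile $P_N$ in steps. At Step $s$, let $N_s(P_N)$ and $A_s(P_N)$ be the sets of agents and objects remaining after Step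 $s-1$ (so $N_1(P_N)=N$, $A_1(P_N)=A$). Each $a\in A_s(P_N)$ is owned by $\tau(\succ_a,N_s(P_N))$. Form the directed graph on $N_s(P_N)$ in which each agent $i$ points to the owner of her most preferred acceptable object in $A_s(P_N)$, or to herself if no object in $A_s(P_N)$ is acceptable to her. Each agent in a cycle of this graph (self-loops included) is assigned her most preferred element of $A_s(P_N)\cup\{a_0\}$; assigned agents and assigned objects are removed. The procedure is repeated until all agents or all objects are assigned; any agent unassigned at the end receives $a_0$. **Serial dictatorship.** An assignment rule is a serial dictatorship if there is a fixed ordering of the agents such that, at every profile, the first agent gets her most preferred element of $A\cup\{a_0\}$, and each subsequent agent in the ordering gets her most preferred element among $a_0$ and the objects not assigned to earlier agents. **Mechanisms.** For a rooted directed tree $T$, let $V(T),E(T),r(T),L(T)$ denote its nodes, edges, root and leaves; $E^{out}(v)$ the outgoing edges of $v$; $s(e)$ the source of $e$. A mechanism on $\mathcal{P}_N$ is a tuple $G=\langle T,\eta^{LA},\eta^{NA},\eta^{EP}\rangle$ where $T$ is a rooted tree, $\eta^{LA}:L(T)\to\mathcal{M}$, $\eta^{NA}:V(T)\setminus L(T)\to N$, and $\eta^{EP}:E(T)\to 2^{\mathbb{L}(A\cup\{a_0\})}\setminus\{\emptyset\}$ such that (a) $\eta^{EP}(e)\cap\eta^{EP}(e')=\emptyset$ for distinct $e,e'$ with $s(e)=s(e')$; (b) for each $v\in V(T)\setminus L(T)$: if on the path $(v^1,\dots,v^t)$ from $r(T)$ to $v$ there is $t'<t$ with $\eta^{NA}(v^{t'})=\eta^{NA}(v)$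 and $\eta^{NA}(v^{s})\ne\eta^{NA}(v)$ for $t'<s<t$, then $\bigcup_{e\in E^{out}(v)}\eta^{EP}(e)=\eta^{EP}(v^{t'},v^{t'+1})$; otherwise $\bigcup_{e\in E^{out}(v)}\eta^{EP}(e)=\mathcal{P}_{\eta^{NA}(v)}$. Each $P_N\in\mathcal{P}_N$ determines a unique root-to-leaf path, following at each node $v$ the outgoing edge $e$ with $P_{\eta^{NA}(v)}\in\eta^{EP}(e)$; $P_N$ passes through the nodes of this path, and $f^G(P_N)=\eta^{LA}(l)$ where $l$ is its leaf. Preferences $P_i,P_i'$ diverge at $v$ if $\eta^{NA}(v)=i$ and they belong to $\eta^{EP}(e),\eta^{EP}(e')$ for two distinct $e,e'\in E^{out}(v)$. **SOSP.** $G$ is SOSP if for all $i\in N$, all $v$ with $\eta^{NA}(v)=i$, and all $P_N,P'_N,\tilde P_N\in\mathcal{P}_N$ passing through $v$ such that $P_i,P'_i$ do not diverge at $v$ and $P_i,\tilde P_i$ diverge at $v$, we have $f^G_i(P'_N)\,R_i\,f^G_i(\tilde P_N)$. An assignment rule $f$ on $\mathcal{P}_N$ is SOSP-implementable if $f=f^G$ for some SOSP mechanism $G$ on $\mathcal{P}_N$. *)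

theory Defs
  imports "HOL-Library.FuncSet" "HOL-Library.While_Combinator"
begin

section \<open>Preferences, allocations, profiles\<close>

text \<open>A pair \<open>(x, y)\<close> in an order means that \<open>x\<close> is ranked strictly above \<open>y\<close>. Orders on
  \<open>X\<close> are required to be subsets of \<open>X \<times> X\<close>, so that there are finitely many of them when \<open>X\<close> is
  finite.\<close>

definition linorders :: "'b set \<Rightarrow> 'b rel set" where
  "linorders X = {r. r \<subseteq> X \<times> X \<and> strict_linear_order_on X r}"

definition best :: "'b rel \<Rightarrow> 'b set \<Rightarrow> 'b" where
  "best r X = (THE x. x \<in> X \<and> (\<forall>y\<in>X. y \<noteq> x \<longrightarrow> (x, y) \<in> r))"

abbreviation weakly_prefers :: "'a rel \<Rightarrow> 'a \<Rightarrow> 'a \<Rightarrow> bool" where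
  "weakly_prefers r x y \<equiv> (x, y) \<in> r \<or> x = y"

type_synonym ('i, 'a) profile = "'i \<Rightarrow> 'a rel"
type_synonym ('i, 'a) allocation = "'i \<Rightarrow> 'a"

text \<open>The outside option \<open>a0\<close> is an element of the same type as the objects, lying outside the
  set \<open>A\<close> of objects.\<close>

definition allocations :: "'i set \<Rightarrow> 'a set \<Rightarrow> 'a \<Rightarrow> ('i, 'a) allocation set" where
  "allocations N A a0 =
     {\<mu> \<in> N \<rightarrow>\<^sub>E insert a0 A. \<forall>a\<in>A. card {i \<in> N. \<mu> i = a} \<le> 1}"

definition full_domain :: "'a set \<Rightarrow> 'a \<Rightarrow> 'i \<Rightarrow> 'a rel set" where
  "full_domain A a0 i = linorders (insert a0 A)"

text \<open>A domain is given by the family \<open>D\<close> of its factors.\<close>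

abbreviation profiles :: "'i set \<Rightarrow> ('i \<Rightarrow> 'a rel set) \<Rightarrow> ('i, 'a) profile set" where
  "profiles N D \<equiv> PiE N D"


section \<open>The fixed priority top trading cycles rule\<close>

definition acceptable :: "'a \<Rightarrow> 'a rel \<Rightarrow> 'a set \<Rightarrow> 'a set" where
  "acceptable a0 r B = {a \<in> B. (a, a0) \<in> r}"

definition owner :: "('a \<Rightarrow> 'i rel) \<Rightarrow> 'i set \<Rightarrow> 'a \<Rightarrow> 'i" where
  "owner prio M a = best (prio a) M"

text \<open>In the following definitions \<open>M\<close> and \<open>B\<close> are the sets of remaining agents and objects.\<close>

definition points_to ::
  "'a \<Rightarrow> ('a \<Rightarrow> 'i rel) \<Rightarrow> ('i, 'a) profile \<Rightarrow> 'i set \<Rightarrow> 'a set \<Rightarrow> 'i \<Rightarrow> 'i" where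
  "points_to a0 prio P M B i =
     (if acceptable a0 (P i) B = {} then i
      else owner prio M (best (P i) (acceptable a0 (P i) B)))"

definition in_cycle ::
  "'a \<Rightarrow> ('a \<Rightarrow> 'i rel) \<Rightarrow> ('i, 'a) profile \<Rightarrow> 'i set \<Rightarrow> 'a set \<Rightarrow> 'i set" where
  "in_cycle a0 prio P M B =
     {i \<in> M. (i, i) \<in> {(j, points_to a0 prio P M B j) | j. j \<in> M}\<^sup>+}"

definition ttc_step ::
  "'a \<Rightarrow> ('a \<Rightarrow> 'i rel) \<Rightarrow> ('i, 'a) profile \<Rightarrow>
   'i set \<times> 'a set \<times> ('i, 'a) allocation \<Rightarrow> 'i set \<times> 'a set \<times> ('i, 'a) allocation" where
  "ttc_step a0 prio P = (\<lambda>(M, B, \<mu>).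
     let C = in_cycle a0 prio P M B;
         \<mu>' = (\<lambda>i. if i \<in> C then best (P i) (insert a0 B) else \<mu> i)
     in (M - C, B - \<mu>' ` C, \<mu>'))"

text \<open>The loop starts with every agent holding \<open>a0\<close>, so agents unassigned at the end receive it.\<close>

definition fpttc ::
  "'i set \<Rightarrow> 'a set \<Rightarrow> 'a \<Rightarrow> ('a \<Rightarrow> 'i rel) \<Rightarrow> ('i, 'a) profile \<Rightarrow> ('i, 'a) allocation" where
  "fpttc N A a0 prio P =
     snd (snd (while (\<lambda>(M, B, \<mu>). M \<noteq> {} \<and> B \<noteq> {}) (ttc_step a0 prio P)
                     (N, A, restrict (\<lambda>i. a0) N)))"


section \<open>Serial dictatorships\<close>

text \<open>Here \<open>(j, i) \<in> r\<close> means that \<open>j\<close> comes before \<open>i\<close> in the ordering of the agents.\<close>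

definition serial_dictatorship ::
  "'i set \<Rightarrow> 'a set \<Rightarrow> 'a \<Rightarrow> ('i \<Rightarrow> 'a rel set) \<Rightarrow>
   (('i, 'a) profile \<Rightarrow> ('i, 'a) allocation) \<Rightarrow> bool" where
  "serial_dictatorship N A a0 D f \<longleftrightarrow>
     (\<exists>r\<in>linorders N. \<forall>P\<in>profiles N D. \<forall>i\<in>N.
        f P i = best (P i) (insert a0 (A - f P ` {j \<in> N. (j, i) \<in> r})))"


section \<open>Mechanisms\<close>

definition root_path :: "('v \<times> 'v) set \<Rightarrow> 'v \<Rightarrow> 'v \<Rightarrow> 'v list \<Rightarrow> bool" where
  "root_path E r v vs \<longleftrightarrow>
     vs \<noteq> [] \<and> hd vs = r \<and> last vs = v \<and> successively (\<lambda>x y. (x, y) \<in> E) vs"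

text \<open>Paths are arbitrary walks here; uniqueness of the walk from \<open>r\<close> to every node excludes
  directed cycles and forces every node other than \<open>r\<close> to have exactly one parent.\<close>

definition rooted_tree :: "'v set \<Rightarrow> ('v \<times> 'v) set \<Rightarrow> 'v \<Rightarrow> bool" where
  "rooted_tree V E r \<longleftrightarrow>
     finite V \<and> r \<in> V \<and> E \<subseteq> V \<times> V \<and> (\<forall>v\<in>V. \<exists>!vs. root_path E r v vs)"

record ('v, 'i, 'a) mechanism =
  tree_nodes :: "'v set"
  tree_edges :: "('v \<times> 'v) set"
  tree_root :: 'v
  leaf_alloc :: "'v \<Rightarrow> ('i, 'a) allocation"
  node_agent :: "'v \<Rightarrow> 'i"
  edge_prefs :: "'v \<times> 'v \<Rightarrow> 'a rel set"

definition out_edges :: "('v, 'i, 'a) mechanism \<Rightarrow> 'v \<Rightarrow> ('v \<times> 'v) set" where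
  "out_edges G v = {e \<in> tree_edges G. fst e = v}"

definition tree_leaves :: "('v, 'i, 'a) mechanism \<Rightarrow> 'v set" where
  "tree_leaves G = {v \<in> tree_nodes G. out_edges G v = {}}"

definition inner_nodes :: "('v, 'i, 'a) mechanism \<Rightarrow> 'v set" where
  "inner_nodes G = tree_nodes G - tree_leaves G"

text \<open>Position \<open>k\<close> on the path \<open>vs\<close> is the last one, before the end of \<open>vs\<close>, at which the agent
  of the final node moves.\<close>

definition previous_move :: "('v, 'i, 'a) mechanism \<Rightarrow> 'v list \<Rightarrow> nat \<Rightarrow> bool" where
  "previous_move G vs k \<longleftrightarrow>
     k < length vs - 1 \<and> node_agent G (vs ! k) = node_agent G (last vs) \<and>
     (\<forall>s. k < s \<and> s < length vs - 1 \<longrightarrow> node_agent G (vs ! s) \<noteq> node_agent G (last vs))"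

definition is_mechanism ::
  "'i set \<Rightarrow> 'a set \<Rightarrow> 'a \<Rightarrow> ('i \<Rightarrow> 'a rel set) \<Rightarrow> ('v, 'i, 'a) mechanism \<Rightarrow> bool" where
  "is_mechanism N A a0 D G \<longleftrightarrow>
     rooted_tree (tree_nodes G) (tree_edges G) (tree_root G) \<and>
     (\<forall>l\<in>tree_leaves G. leaf_alloc G l \<in> allocations N A a0) \<and>
     (\<forall>v\<in>inner_nodes G. node_agent G v \<in> N) \<and>
     (\<forall>e\<in>tree_edges G. edge_prefs G e \<subseteq> linorders (insert a0 A) \<and> edge_prefs G e \<noteq> {}) \<and>
     (\<forall>e\<in>tree_edges G. \<forall>e'\<in>tree_edges G.
        e \<noteq> e' \<and> fst e = fst e' \<longrightarrow> edge_prefs G e \<inter> edge_prefs G e' = {}) \<and>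
     (\<forall>v\<in>inner_nodes G. \<forall>vs. root_path (tree_edges G) (tree_root G) v vs \<longrightarrow>
        (\<forall>k. previous_move G vs k \<longrightarrow>
           (\<Union>e\<in>out_edges G v. edge_prefs G e) = edge_prefs G (vs ! k, vs ! Suc k)) \<and>
        ((\<nexists>k. previous_move G vs k) \<longrightarrow>
           (\<Union>e\<in>out_edges G v. edge_prefs G e) = D (node_agent G v)))"

inductive passes_through :: "('v, 'i, 'a) mechanism \<Rightarrow> ('i, 'a) profile \<Rightarrow> 'v \<Rightarrow> bool"
  for G P where
  root: "passes_through G P (tree_root G)"
| step: "passes_through G P v \<Longrightarrow> (v, w) \<in> tree_edges G \<Longrightarrow>
           P (node_agent G v) \<in> edge_prefs G (v, w) \<Longrightarrow> passes_through G P w"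

definition induced_rule ::
  "('v, 'i, 'a) mechanism \<Rightarrow> ('i, 'a) profile \<Rightarrow> ('i, 'a) allocation" where
  "induced_rule G P = leaf_alloc G (THE l. l \<in> tree_leaves G \<and> passes_through G P l)"

definition diverge :: "('v, 'i, 'a) mechanism \<Rightarrow> 'v \<Rightarrow> 'i \<Rightarrow> 'a rel \<Rightarrow> 'a rel \<Rightarrow> bool" where
  "diverge G v i Q Q' \<longleftrightarrow>
     node_agent G v = i \<and>
     (\<exists>e\<in>out_edges G v. \<exists>e'\<in>out_edges G v.
        e \<noteq> e' \<and> Q \<in> edge_prefs G e \<and> Q' \<in> edge_prefs G e')"

definition SOSP ::
  "'i set \<Rightarrow> ('i \<Rightarrow> 'a rel set) \<Rightarrow> ('v, 'i, 'a) mechanism \<Rightarrow> bool" where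
  "SOSP N D G \<longleftrightarrow>
     (\<forall>i\<in>N. \<forall>v\<in>inner_nodes G. node_agent G v = i \<longrightarrow>
       (\<forall>P\<in>profiles N D. \<forall>P'\<in>profiles N D. \<forall>Pt\<in>profiles N D.
          passes_through G P v \<and> passes_through G P' v \<and> passes_through G Pt v \<and>
          \<not> diverge G v i (P i) (P' i) \<and> diverge G v i (P i) (Pt i) \<longrightarrow>
          weakly_prefers (P i) (induced_rule G P' i) (induced_rule G Pt i)))"

text \<open>The nodes of the mechanism are natural numbers. This is no restriction, since trees are
  finite and their nodes can be renamed.\<close>

definition SOSP_implementable ::
  "'i set \<Rightarrow> 'a set \<Rightarrow> 'a \<Rightarrow> ('i \<Rightarrow> 'a rel set) \<Rightarrow>
   (('i, 'a) profile \<Rightarrow> ('i, 'a) allocation) \<Rightarrow> bool" where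
  "SOSP_implementable N A a0 D f \<longleftrightarrow>
     (\<exists>G :: (nat, 'i, 'a) mechanism.
        is_mechanism N A a0 D G \<and> SOSP N D G \<and> (\<forall>P\<in>profiles N D. f P = induced_rule G P))"

end

theory Submission
  imports Defs "HOL-Library.Nat_Bijection"
begin

text \<open>Suppose \<open>a\<close> ranks \<open>i\<close> above \<open>j\<close> while \<open>b\<close> ranks \<open>j\<close> above \<open>i\<close>. Let the other agents find
  nothing acceptable and let \<open>i\<close> choose among the rankings \<open>ab\<close>, \<open>ba\<close> and \<open>b\<close> of acceptable objects,
  \<open>j\<close> among \<open>ba\<close>, \<open>ab\<close> and \<open>a\<close>. An SOSP mechanism cannot separate \<open>ba\<close> from \<open>b\<close> for \<open>i\<close>: with \<open>ba\<close> she
  may end up with \<open>a\<close> and with \<open>b\<close> she may get \<open>b\<close>. As \<open>ba\<close> and \<open>b\<close> are pooled, it cannot separate \<open>ba\<close>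
  from \<open>ab\<close> either, since \<open>b\<close> may yield \<open>a0\<close> while \<open>ab\<close> always yields \<open>a\<close>. The same holds for \<open>j\<close>, so
  all these profiles reach the same leaf although the rule is not constant on them. Hence SOSP
  implementation forces all objects to have the same priority order, and then the FPTTC rule is
  the serial dictatorship in that order. Conversely, a serial dictatorship is implemented by
  letting the agents reveal their preferences one after another.\<close>

section \<open>Linear orders\<close>

lemma linorders_iff:
  "r \<in> linorders X \<longleftrightarrow> r \<subseteq> X \<times> X \<and> trans r \<and> irrefl r \<and> total_on X r"
  by (auto simp: linorders_def strict_linear_order_on_def)

lemma linorders_asym:
  assumes "r \<in> linorders X" "(x, y) \<in> r"
  shows "(y, x) \<notin> r"
  using assms unfolding linorders_iff irrefl_def by (meson transD)

lemma linorders_total: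
  assumes "r \<in> linorders X" "x \<in> X" "y \<in> X" "x \<noteq> y" "(x, y) \<notin> r"
  shows "(y, x) \<in> r"
  using assms unfolding linorders_iff total_on_def by blast

lemma finite_linorders: "finite X \<Longrightarrow> finite (linorders X)"
  by (rule finite_subset[of _ "Pow (X \<times> X)"]) (auto simp: linorders_iff)

lemma best_eqI:
  assumes "r \<in> linorders X" "x \<in> Y" "\<And>y. y \<in> Y \<Longrightarrow> y \<noteq> x \<Longrightarrow> (x, y) \<in> r"
  shows "best r Y = x"
  unfolding best_def
proof (rule the_equality)
  fix z assume z: "z \<in> Y \<and> (\<forall>y\<in>Y. y \<noteq> z \<longrightarrow> (z, y) \<in> r)"
  then show "z = x" using assms linorders_asym[OF assms(1)] by metis
qed (use assms in blast)

lemma ex_best: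
  assumes r: "r \<in> linorders X" and Y: "finite Y" "Y \<noteq> {}" "Y \<subseteq> X"
  shows "\<exists>x\<in>Y. \<forall>y\<in>Y. y \<noteq> x \<longrightarrow> (x, y) \<in> r"
  using Y
proof (induction Y rule: finite_ne_induct)
  case (insert z Y)
  then obtain x where x: "x \<in> Y" "\<forall>y\<in>Y. y \<noteq> x \<longrightarrow> (x, y) \<in> r" by auto
  have tr: "trans r" using r by (simp add: linorders_iff)
  show ?case
  proof (cases "(x, z) \<in> r")
    case True
    then show ?thesis using x by blast
  next
    case False
    then have "(z, x) \<in> r" using linorders_total[OF r] insert x by blast
    then have "\<forall>y\<in>Y. (z, y) \<in> r" using x transD[OF tr, of z x] by auto
    then show ?thesis by blast
  qed
qed simp

lemma
  assumes r: "r \<in> linorders X" and Y: "finite Y" "Y \<noteq> {}" "Y \<subseteq> X"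
  shows best_in: "best r Y \<in> Y"
    and best_above: "y \<in> Y \<Longrightarrow> y \<noteq> best r Y \<Longrightarrow> (best r Y, y) \<in> r"
proof -
  obtain x where x: "x \<in> Y" "\<forall>y\<in>Y. y \<noteq> x \<longrightarrow> (x, y) \<in> r"
    using ex_best[OF r Y] by blast
  then have "best r Y = x" using best_eqI[OF r] by blast
  then show "best r Y \<in> Y" "y \<in> Y \<Longrightarrow> y \<noteq> best r Y \<Longrightarrow> (best r Y, y) \<in> r"
    using x by auto
qed

lemma ex_linorder:
  assumes "finite X"
  shows "\<exists>r. r \<in> linorders X"
proof -
  obtain h :: "'a \<Rightarrow> nat" where h: "inj_on h X"
    using assms by (meson finite_imp_inj_to_nat_seg)
  have "{(x, y). x \<in> X \<and> y \<in> X \<and> h x < h y} \<in> linorders X"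
    using h unfolding linorders_iff trans_def irrefl_def total_on_def
    by (auto dest: inj_onD) (metis inj_onD linorder_neqE_nat)
  then show ?thesis by blast
qed

text \<open>Nested promotions build preferences with prescribed leading entries: the outermost
  promoted element comes first, and elements never promoted keep their relative order.\<close>

definition promote :: "'b set \<Rightarrow> 'b \<Rightarrow> 'b rel \<Rightarrow> 'b rel" where
  "promote X x r = {(u, v). v \<noteq> x \<and> (u = x \<and> v \<in> X \<or> u \<noteq> x \<and> (u, v) \<in> r)}"

lemma promote_linorders:
  assumes "r \<in> linorders X" "x \<in> X"
  shows "promote X x r \<in> linorders X"
proof -
  have r: "r \<subseteq> X \<times> X" "trans r" "irrefl r" "total_on X r"
    using assms(1) by (simp_all add: linorders_iff)
  have "trans (promote X x r)"
  proof (rule transI)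
    fix u v w assume "(u, v) \<in> promote X x r" "(v, w) \<in> promote X x r"
    then show "(u, w) \<in> promote X x r"
      using r(1) transD[OF r(2), of u v w] by (auto simp: promote_def)
  qed
  moreover have "irrefl (promote X x r)"
    using r(3) by (auto simp: irrefl_def promote_def)
  moreover have "total_on X (promote X x r)"
    using r(4) by (auto simp: total_on_def promote_def)
  moreover have "promote X x r \<subseteq> X \<times> X"
    using r(1) assms(2) by (auto simp: promote_def)
  ultimately show ?thesis by (simp add: linorders_iff)
qed

text \<open>Taking off the top element again and again lists any subset in decreasing order;
  \<open>\<sigma>\<close> reads the list for \<open>N\<close> by position. It later fixes the order
  of moves in the revelation mechanism.\<close>

lemma enumerate_linorder:
  assumes "finite N" "r \<in> linorders N"
  shows "\<exists>\<sigma>. bij_betw \<sigma> {..<card N} N \<and> (\<forall>p q. p < q \<and> q < card N \<longrightarrow> (\<sigma> p, \<sigma> q) \<in> r)"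
proof -
  have "\<exists>xs. set xs = M \<and> distinct xs \<and> sorted_wrt (\<lambda>x y. (x, y) \<in> r) xs"
    if "finite M" "M \<subseteq> N" for M
    using that
  proof (induction M rule: finite_remove_induct)
    case (remove M)
    let ?t = "best r M"
    have t: "?t \<in> M" "\<forall>y\<in>M - {?t}. (?t, y) \<in> r"
      using best_in[OF assms(2)] best_above[OF assms(2)] remove by auto
    obtain xs where "set xs = M - {?t}" "distinct xs" "sorted_wrt (\<lambda>x y. (x, y) \<in> r) xs"
      using remove.IH[OF t(1)] remove.prems by blast
    then have "set (?t # xs) = M \<and> distinct (?t # xs) \<and> sorted_wrt (\<lambda>x y. (x, y) \<in> r) (?t # xs)"
      using t by auto
    then show ?case by blast
  qed simp
  then obtain xs where xs: "set xs = N" "distinct xs" "sorted_wrt (\<lambda>x y. (x, y) \<in> r) xs"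
    using assms(1) by blast
  have len: "length xs = card N" using xs distinct_card by metis
  have "bij_betw ((!) xs) {..<card N} N"
    using bij_betw_nth[OF xs(2)] xs(1) len by simp
  moreover have "\<forall>p q. p < q \<and> q < card N \<longrightarrow> (xs ! p, xs ! q) \<in> r"
    using xs(3) len by (simp add: sorted_wrt_iff_nth_less)
  ultimately show ?thesis by blast
qed


section \<open>Computing the FPTTC rule\<close>

text \<open>As \<open>k\<close> points to herself, she is the only agent reachable from
  \<open>i\<close>, so no path returns to \<open>i\<close>.\<close>

lemma not_in_cycle_if_sink:
  assumes "points_to a0 prio P M B i = k" "points_to a0 prio P M B k = k" "k \<noteq> i"
  shows "i \<notin> in_cycle a0 prio P M B"
proof
  let ?R = "{(j, points_to a0 prio P M B j) | j. j \<in> M}"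
  assume "i \<in> in_cycle a0 prio P M B"
  then have "(i, i) \<in> ?R\<^sup>+" by (simp add: in_cycle_def)
  moreover have "y = k" if "(i, y) \<in> ?R\<^sup>+" for y
    using that by induction (use assms in auto)
  ultimately show False using assms(3) by blast
qed

locale fpttc_market =
  fixes N :: "'i set" and A :: "'a set" and a0 :: 'a and prio :: "'a \<Rightarrow> 'i rel"
  assumes finN: "finite N" and finA: "finite A" and a0: "a0 \<notin> A"
    and prio: "\<And>a. a \<in> A \<Longrightarrow> prio a \<in> linorders N"
begin

abbreviation prefs :: "'a rel set" where
  "prefs \<equiv> linorders (insert a0 A)"

lemma owner_in:
  assumes "a \<in> A" "M \<subseteq> N" "M \<noteq> {}"
  shows "owner prio M a \<in> M"
  unfolding owner_def using best_in[OF prio] assms finN by (meson rev_finite_subset)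

text \<open>Every agent of \<open>M\<close> points into \<open>M\<close>, whereas a finite acyclic
  graph has a vertex without successor. This fact makes the loop of \<open>fpttc\<close>
  terminate.\<close>

lemma in_cycle_nonempty:
  assumes P: "\<And>i. i \<in> N \<Longrightarrow> P i \<in> prefs" and M: "M \<subseteq> N" "M \<noteq> {}" and B: "B \<subseteq> A"
  shows "in_cycle a0 prio P M B \<noteq> {}"
proof
  let ?p = "points_to a0 prio P M B"
  let ?R = "{(j, ?p j) | j. j \<in> M}"
  assume "in_cycle a0 prio P M B = {}"
  moreover have "x \<in> M" if "(x, y) \<in> ?R\<^sup>+" for x y
    using tranclD[OF that] by auto
  ultimately have "acyclic ?R" unfolding in_cycle_def acyclic_def by blast
  moreover have finM: "finite M" using M finN by (rule_tac finite_subset)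
  then have "finite ?R" by simp
  ultimately have "wf (?R\<inverse>)" by (rule_tac finite_acyclic_wf_converse)
  moreover obtain z0 where "z0 \<in> M" using M(2) by blast
  \<comment> \<open>Minimality for the converse relation means that \<open>z\<close> has no
    successor in \<open>M\<close>.\<close>
  ultimately obtain z where z: "z \<in> M" "\<And>y. (y, z) \<in> ?R\<inverse> \<Longrightarrow> y \<notin> M"
    by (rule wfE_min) blast
  have "?p z \<in> M"
  proof (cases "acceptable a0 (P z) B = {}")
    case True
    then show ?thesis using z(1) by (simp add: points_to_def)
  next
    case False
    have "best (P z) (acceptable a0 (P z) B) \<in> acceptable a0 (P z) B"
      using z(1) M B False finA
      by (intro best_in[OF P]) (auto simp: acceptable_def intro: finite_subset)
    then have "best (P z) (acceptable a0 (P z) B) \<in> A" using B by (auto simp: acceptable_def)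
    then show ?thesis using owner_in M False by (simp add: points_to_def)
  qed
  moreover have "(?p z, z) \<in> ?R\<inverse>" using z(1) by blast
  ultimately show False using z(2) by blast
qed

text \<open>An invariant rule for the loop. Each round removes at least one agent, since some agent
  lies on a cycle, so the number of remaining agents decreases; \<open>M \<subseteq> N\<close> and
  \<open>B \<subseteq> A\<close> are maintained along with \<open>I\<close>.\<close>

lemma fpttc_induct:
  assumes P: "\<And>i. i \<in> N \<Longrightarrow> P i \<in> prefs"
    and start: "I N A (restrict (\<lambda>i. a0) N)"
    and step: "\<And>M B \<mu> C \<mu>'. I M B \<mu> \<Longrightarrow> M \<subseteq> N \<Longrightarrow> B \<subseteq> A \<Longrightarrow>
      C = in_cycle a0 prio P M B \<Longrightarrow> C \<subseteq> M \<Longrightarrow>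
      \<mu>' = (\<lambda>i. if i \<in> C then best (P i) (insert a0 B) else \<mu> i) \<Longrightarrow> I (M - C) (B - \<mu>' ` C) \<mu>'"
    and fin: "\<And>M B \<mu>. I M B \<mu> \<Longrightarrow> M \<subseteq> N \<Longrightarrow> B \<subseteq> A \<Longrightarrow> M = {} \<or> B = {} \<Longrightarrow> Q \<mu>"
  shows "Q (fpttc N A a0 prio P)"
  unfolding fpttc_def
proof (rule while_rule[where P = "\<lambda>(M, B, \<mu>). I M B \<mu> \<and> M \<subseteq> N \<and> B \<subseteq> A"
      and r = "measure (\<lambda>s. card (fst s))"])
  show "case (N, A, \<lambda>i\<in>N. a0) of (M, B, \<mu>) \<Rightarrow> I M B \<mu> \<and> M \<subseteq> N \<and> B \<subseteq> A"
    using start by simp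
next
  fix s assume "case s of (M, B, \<mu>) \<Rightarrow> I M B \<mu> \<and> M \<subseteq> N \<and> B \<subseteq> A"
    "case s of (M, B, \<mu>) \<Rightarrow> M \<noteq> {} \<and> B \<noteq> {}"
  moreover obtain M B \<mu> where s: "s = (M, B, \<mu>)" by (cases s)
  ultimately have MB: "I M B \<mu>" "M \<subseteq> N" "B \<subseteq> A" "M \<noteq> {}" by auto
  define C where "C = in_cycle a0 prio P M B"
  define \<mu>' where "\<mu>' = (\<lambda>i. if i \<in> C then best (P i) (insert a0 B) else \<mu> i)"
  have stp: "ttc_step a0 prio P s = (M - C, B - \<mu>' ` C, \<mu>')"
    by (simp add: ttc_step_def s C_def \<mu>'_def Let_def)
  have C: "C \<subseteq> M" by (auto simp: C_def in_cycle_def)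
  show "case ttc_step a0 prio P s of (M, B, \<mu>) \<Rightarrow> I M B \<mu> \<and> M \<subseteq> N \<and> B \<subseteq> A"
    using step[OF MB(1-3) C_def C \<mu>'_def] MB stp by auto
  have "C \<noteq> {}" unfolding C_def using in_cycle_nonempty[of P M B] P MB by blast
  then have "M - C \<subset> M" using C by blast
  then have "card (M - C) < card M"
    using MB(2) finN by (meson psubset_card_mono rev_finite_subset)
  then show "(ttc_step a0 prio P s, s) \<in> measure (\<lambda>s. card (fst s))"
    unfolding stp by (simp add: s)
next
  fix s assume "case s of (M, B, \<mu>) \<Rightarrow> I M B \<mu> \<and> M \<subseteq> N \<and> B \<subseteq> A"
    "\<not> (case s of (M, B, \<mu>) \<Rightarrow> M \<noteq> {} \<and> B \<noteq> {})"
  then show "Q (snd (snd s))" using fin by (auto split: prod.splits)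
qed simp

text \<open>Values are written only for agents of \<open>M \<subseteq> N\<close>, so the initial
  restriction to \<open>N\<close> persists. Membership in \<open>allocations\<close> demands
  this.\<close>

lemma fpttc_extensional:
  assumes "\<And>i. i \<in> N \<Longrightarrow> P i \<in> prefs"
  shows "fpttc N A a0 prio P \<in> extensional N"
  using assms
proof (rule fpttc_induct[where I = "\<lambda>M B \<mu>. \<mu> \<in> extensional N"
      and Q = "\<lambda>\<mu>. \<mu> \<in> extensional N"])
  fix M B \<mu> C and \<mu>' :: "'i \<Rightarrow> 'a"
  assume "\<mu> \<in> extensional N" "M \<subseteq> N" "C \<subseteq> M"
    "\<mu>' = (\<lambda>i. if i \<in> C then best (P i) (insert a0 B) else \<mu> i)"
  then show "\<mu>' \<in> extensional N" by (auto simp: extensional_def)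
qed simp_all

text \<open>Every agent leaving the market removes exactly the object \<open>\<nu>\<close> gives her, so the remaining
  objects are determined by the set \<open>M\<close> of remaining agents and only \<open>M\<close> has to be considered.\<close>

lemma fpttc_eqI:
  assumes P: "\<And>i. i \<in> N \<Longrightarrow> P i \<in> prefs"
    and \<nu>: "\<nu> \<in> N \<rightarrow> insert a0 A"
    and inj: "\<And>i j. i \<in> N \<Longrightarrow> j \<in> N \<Longrightarrow> \<nu> i = \<nu> j \<Longrightarrow> \<nu> i \<in> A \<Longrightarrow> i = j"
    and cycle: "\<And>M B i. M \<subseteq> N \<Longrightarrow> B = A - \<nu> ` (N - M) \<Longrightarrow> \<nu> ` M \<subseteq> insert a0 B \<Longrightarrow>
      i \<in> M \<Longrightarrow> i \<in> in_cycle a0 prio P M B \<Longrightarrow> best (P i) (insert a0 B) = \<nu> i"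
  shows "fpttc N A a0 prio P = restrict \<nu> N"
  using P
\<comment> \<open>Agents still in the market hold the initial \<open>a0\<close>, departed agents
  hold their value of \<open>\<nu>\<close>.\<close>
proof (rule fpttc_induct[where I = "\<lambda>M B \<mu>. B = A - \<nu> ` (N - M) \<and>
      \<mu> = restrict (\<lambda>i. if i \<in> M then a0 else \<nu> i) N"])
  \<comment> \<open>By injectivity on objects, no departed agent has taken what \<open>\<nu>\<close>
    reserves for a remaining one.\<close>
  have remaining: "\<nu> ` M \<subseteq> insert a0 (A - \<nu> ` (N - M))" if "M \<subseteq> N" for M
  proof -
    have "\<nu> i \<in> insert a0 (A - \<nu> ` (N - M))" if "i \<in> M" for i
    proof -
      have "\<nu> i \<in> insert a0 A" "\<And>j. j \<in> N - M \<Longrightarrow> \<nu> i \<in> A \<Longrightarrow> \<nu> i \<noteq> \<nu> j"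
        using \<nu> inj that \<open>M \<subseteq> N\<close> by blast+
      then show ?thesis by auto
    qed
    then show ?thesis by (rule image_subsetI)
  qed
  {
    fix M B \<mu> C \<mu>'
    assume I: "B = A - \<nu> ` (N - M) \<and> \<mu> = restrict (\<lambda>i. if i \<in> M then a0 else \<nu> i) N"
      and M: "M \<subseteq> N" and C: "C = in_cycle a0 prio P M B" "C \<subseteq> M"
      and \<mu>': "\<mu>' = (\<lambda>i. if i \<in> C then best (P i) (insert a0 B) else \<mu> i)"
    have best: "best (P i) (insert a0 B) = \<nu> i" if "i \<in> C" for i
      using cycle[OF M] I remaining[OF M] C that by auto
    have "\<mu>' = restrict (\<lambda>i. if i \<in> M - C then a0 else \<nu> i) N"
      using I M C(2) best by (auto simp: \<mu>' restrict_def fun_eq_iff)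
    moreover have "\<mu>' ` C = \<nu> ` C" using best by (auto simp: \<mu>')
    moreover have "N - (M - C) = (N - M) \<union> C" using M C(2) by blast
    ultimately show "B - \<mu>' ` C = A - \<nu> ` (N - (M - C)) \<and>
        \<mu>' = restrict (\<lambda>i. if i \<in> M - C then a0 else \<nu> i) N"
      using I by auto
  next
    fix M B \<mu>
    assume I: "B = A - \<nu> ` (N - M) \<and> \<mu> = restrict (\<lambda>i. if i \<in> M then a0 else \<nu> i) N"
      and M: "M \<subseteq> N" and fin: "M = {} \<or> B = {}"
    \<comment> \<open>If the objects run out first, \<open>remaining\<close> leaves only
      \<open>a0\<close> as the value of \<open>\<nu>\<close>, which agrees with the default the
      agent still holds.\<close>
    have "\<nu> i = a0" if "i \<in> M" for i
    proof -
      have "B = {}" using fin that by blast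
      then show ?thesis using remaining[OF M] I that by auto
    qed
    then show "\<mu> = restrict \<nu> N" using I by (auto simp: restrict_def fun_eq_iff)
  }
qed (auto simp: restrict_def fun_eq_iff)

text \<open>When \<open>\<nu>\<close> gives everyone her overall favourite, that favourite is still
  available as long as she remains, so she takes it in whatever cycle she leaves.\<close>

lemma fpttc_top_choices:
  assumes P: "\<And>i. i \<in> N \<Longrightarrow> P i \<in> prefs"
    and \<nu>: "\<nu> \<in> N \<rightarrow> insert a0 A"
    and inj: "\<And>i j. i \<in> N \<Longrightarrow> j \<in> N \<Longrightarrow> \<nu> i = \<nu> j \<Longrightarrow> \<nu> i \<in> A \<Longrightarrow> i = j"
    and top: "\<And>i x. i \<in> N \<Longrightarrow> x \<in> insert a0 A \<Longrightarrow> x \<noteq> \<nu> i \<Longrightarrow> (\<nu> i, x) \<in> P i"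
  shows "fpttc N A a0 prio P = restrict \<nu> N"
  using P \<nu> inj
proof (rule fpttc_eqI)
  fix M B i assume "M \<subseteq> N" "B = A - \<nu> ` (N - M)" "\<nu> ` M \<subseteq> insert a0 B" "i \<in> M"
  then show "best (P i) (insert a0 B) = \<nu> i"
    using top by (intro best_eqI[OF P]) auto
qed


section \<open>Common priorities\<close>

text \<open>Well-founded recursion along the finite acyclic relation \<open>r\<close>: the choice at
  \<open>i\<close> refers only to strict predecessors of \<open>i\<close>.\<close>

lemma ex_serial_allocation:
  assumes "r \<in> linorders N"
  shows "\<exists>\<nu>. \<forall>i. \<nu> i = best (P i) (insert a0 (A - \<nu> ` {j \<in> N. (j, i) \<in> r}))"
proof -
  define F where "F = (\<lambda>\<nu> i. best (P i) (insert a0 (A - \<nu> ` {j \<in> N. (j, i) \<in> r})))"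
  have "finite r" "acyclic r"
    using assms finN unfolding linorders_iff
    by (auto intro: finite_subset simp: acyclic_irrefl trancl_id)
  then have "wf r" by (rule finite_acyclic_wf)
  moreover have "adm_wf r F"
  proof -
    have "F f x = F g x" if "\<forall>z. (z, x) \<in> r \<longrightarrow> f z = g z" for f g x
    proof -
      have "f ` {j \<in> N. (j, x) \<in> r} = g ` {j \<in> N. (j, x) \<in> r}"
        using that by (auto intro!: image_cong)
      then show ?thesis by (simp add: F_def)
    qed
    then show ?thesis by (simp add: adm_wf_def)
  qed
  ultimately have "wfrec r F = F (wfrec r F)" by (rule wfrec_fixpoint)
  then have "wfrec r F i = F (wfrec r F) i" for i by (rule fun_cong)
  then show ?thesis unfolding F_def by blast
qed

text \<open>Only the choice equation on \<open>N\<close> is assumed, so that the facts apply both to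
  the allocation built by recursion and to the values of \<open>fpttc\<close> once it is known to be
  a serial dictatorship.\<close>

lemma serial_allocation_props:
  assumes P: "P \<in> N \<rightarrow> prefs" and r: "r \<in> linorders N"
    and \<nu>: "\<And>i. i \<in> N \<Longrightarrow> \<nu> i = best (P i) (insert a0 (A - \<nu> ` {j \<in> N. (j, i) \<in> r}))"
  shows "i \<in> N \<Longrightarrow> \<nu> i \<in> insert a0 (A - \<nu> ` {j \<in> N. (j, i) \<in> r})"
    and "i \<in> N \<Longrightarrow> x \<in> insert a0 (A - \<nu> ` {j \<in> N. (j, i) \<in> r}) \<Longrightarrow> x \<noteq> \<nu> i \<Longrightarrow> (\<nu> i, x) \<in> P i"
    and "i \<in> N \<Longrightarrow> j \<in> N \<Longrightarrow> \<nu> i = \<nu> j \<Longrightarrow> \<nu> i \<in> A \<Longrightarrow> i = j"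
proof -
  define Y where "Y i = insert a0 (A - \<nu> ` {j \<in> N. (j, i) \<in> r})" for i
  have Y: "finite (Y i)" "Y i \<noteq> {}" "Y i \<subseteq> insert a0 A" for i
    using finA by (auto simp: Y_def)
  have best: "best (P i) (Y i) = \<nu> i" if "i \<in> N" for i
    unfolding Y_def by (rule \<nu>[OF that, symmetric])
  have "\<nu> i \<in> Y i" if "i \<in> N" for i
    using best_in[OF funcset_mem[OF P that] Y[of i]] unfolding best[OF that] .
  then show mem: "\<nu> i \<in> insert a0 (A - \<nu> ` {j \<in> N. (j, i) \<in> r})" if "i \<in> N" for i
    using that unfolding Y_def by blast
  have "(\<nu> i, x) \<in> P i" if "i \<in> N" "x \<in> Y i" "x \<noteq> \<nu> i" for x
    using best_above[OF funcset_mem[OF P that(1)] Y[of i] that(2)] that(3) unfolding best[OF that(1)] .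
  then show "(\<nu> i, x) \<in> P i"
    if "i \<in> N" "x \<in> insert a0 (A - \<nu> ` {j \<in> N. (j, i) \<in> r})" "x \<noteq> \<nu> i"
    using that unfolding Y_def by blast
  \<comment> \<open>The object taken by \<open>k\<close> is missing from the menu of the later agent
    \<open>l\<close>.\<close>
  have distinct: "\<nu> k \<noteq> \<nu> l" if "k \<in> N" "l \<in> N" "(k, l) \<in> r" "\<nu> l \<in> A" for k l
  proof -
    have "\<nu> k \<in> \<nu> ` {j \<in> N. (j, l) \<in> r}" using that(1,3) by (intro imageI) simp
    moreover have "\<nu> l \<noteq> a0" using that(4) a0 by blast
    ultimately show ?thesis using mem[OF that(2)] by auto
  qed
  show "i = j" if "i \<in> N" "j \<in> N" "\<nu> i = \<nu> j" "\<nu> i \<in> A"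
    using linorders_total[OF r that(1,2)] distinct[OF that(1,2)] distinct[OF that(2,1)] that(3,4)
    by argo
qed

text \<open>With one priority order, the top remaining agent owns every remaining object. All others
  point to her or to themselves, so the only cycles are self-loops: hers, and those of agents
  without acceptable objects.\<close>

lemma serial_dictatorship_if_common_priority:
  assumes r: "r \<in> linorders N" and common: "\<And>a. a \<in> A \<Longrightarrow> prio a = r"
  shows "serial_dictatorship N A a0 (full_domain A a0) (fpttc N A a0 prio)"
  unfolding serial_dictatorship_def
proof (intro bexI[OF _ r] ballI)
  fix P i assume P: "P \<in> profiles N (full_domain A a0)" and i: "i \<in> N"
  then have Pl: "\<And>k. k \<in> N \<Longrightarrow> P k \<in> prefs" by (auto simp: full_domain_def)
  obtain \<nu> where \<nu>: "\<And>i. \<nu> i = best (P i) (insert a0 (A - \<nu> ` {j \<in> N. (j, i) \<in> r}))"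
    using ex_serial_allocation[OF r] by blast
  have "P \<in> N \<rightarrow> prefs" using Pl by blast
  note props = serial_allocation_props[OF this r \<nu>]
  have eq: "fpttc N A a0 prio P = restrict \<nu> N"
    using Pl _ props(3)
  proof (rule fpttc_eqI)
    show "\<nu> \<in> N \<rightarrow> insert a0 A" using props(1) by blast
  next
    fix M B k
    assume M: "M \<subseteq> N" and B: "B = A - \<nu> ` (N - M)" "\<nu> ` M \<subseteq> insert a0 B"
      and k: "k \<in> M" "k \<in> in_cycle a0 prio P M B"
    let ?t = "best r M"
    have finM: "finite M" using M finN by (rule finite_subset)
    have t: "?t \<in> M" "\<And>j. j \<in> M \<Longrightarrow> j \<noteq> ?t \<Longrightarrow> (?t, j) \<in> r"
      using best_in[OF r finM _ M] best_above[OF r finM _ M] k by auto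
    have acc: "best (P j) (acceptable a0 (P j) B) \<in> A" if "j \<in> M" "acceptable a0 (P j) B \<noteq> {}" for j
      using best_in[OF Pl, of j "acceptable a0 (P j) B"] that M B(1) finA
      by (auto simp: acceptable_def)
    have pt: "points_to a0 prio P M B j = (if acceptable a0 (P j) B = {} then j else ?t)"
      if "j \<in> M" for j
      using acc[OF that] common by (simp add: points_to_def owner_def)
    have kN: "k \<in> N" using k(1) M by blast
    have kB: "\<nu> k \<in> insert a0 B" by (rule subsetD[OF B(2) imageI[OF k(1)]])
    show "best (P k) (insert a0 B) = \<nu> k"
    proof (cases "k = ?t")
      case True
      \<comment> \<open>All predecessors of the top remaining agent have left, so everything still
        in the market was also on her menu in the dictatorship.\<close>
      have "{j \<in> N. (j, k) \<in> r} \<subseteq> N - M"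
        using t(2) linorders_asym[OF r] True r unfolding linorders_iff irrefl_def by blast
      then have "insert a0 B \<subseteq> insert a0 (A - \<nu> ` {j \<in> N. (j, k) \<in> r})"
        unfolding B(1) by blast
      then show ?thesis using kB by (intro best_eqI[OF Pl[OF kN]] props(2)[OF kN]) blast+
    next
      case False
      \<comment> \<open>Otherwise \<open>k\<close> would point to the sink \<open>?t\<close> and lie
        on no cycle.\<close>
      have "acceptable a0 (P k) B = {}"
      proof (rule ccontr)
        assume "acceptable a0 (P k) B \<noteq> {}"
        then have "k \<notin> in_cycle a0 prio P M B"
          using False by (intro not_in_cycle_if_sink[of _ _ _ _ _ _ ?t]) (auto simp: pt k t(1))
        then show False using k by blast
      qed
      then have none: "(a0, x) \<in> P k" if "x \<in> B" for x
        using that linorders_total[OF Pl[OF kN], of x a0] B(1) a0 by (auto simp: acceptable_def)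
      \<comment> \<open>The dictatorship gives \<open>k\<close> something at least as good as
        \<open>a0\<close>, but it must come from \<open>insert a0 B\<close>, where every object is
        worse than \<open>a0\<close>.\<close>
      have "\<nu> k = a0"
      proof (rule ccontr)
        assume ne: "\<nu> k \<noteq> a0"
        then have "(a0, \<nu> k) \<in> P k" using none kB by blast
        moreover have "(\<nu> k, a0) \<in> P k" using props(2)[OF kN, of a0] ne by simp
        ultimately show False using linorders_asym[OF Pl[OF kN]] by blast
      qed
      then show ?thesis using none by (intro best_eqI[OF Pl[OF kN]]) auto
    qed
  qed
  have "restrict \<nu> N ` {j \<in> N. (j, i) \<in> r} = \<nu> ` {j \<in> N. (j, i) \<in> r}" by auto
  then show "fpttc N A a0 prio P i =
      best (P i) (insert a0 (A - fpttc N A a0 prio P ` {j \<in> N. (j, i) \<in> r}))"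
    using \<nu>[of i] i by (simp add: eq)
qed

end

section \<open>Conflicting priorities\<close>

lemma passes_through_in_nodes:
  assumes "is_mechanism N A a0 D G" "passes_through G P v"
  shows "v \<in> tree_nodes G"
  using assms(2) by cases (use assms(1) in \<open>auto simp: is_mechanism_def rooted_tree_def\<close>)

lemma passes_through_root_path:
  assumes "passes_through G P v"
  shows "\<exists>vs. root_path (tree_edges G) (tree_root G) v vs \<and>
    (\<forall>k<length vs - 1. P (node_agent G (vs ! k)) \<in> edge_prefs G (vs ! k, vs ! Suc k))"
  using assms
proof induction
  case root
  have "root_path (tree_edges G) (tree_root G) (tree_root G) [tree_root G]"
    by (simp add: root_path_def)
  then show ?case by (intro exI[of _ "[tree_root G]"]) simp
next
  case (step v w)
  then obtain vs where vs: "root_path (tree_edges G) (tree_root G) v vs"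
    "\<forall>k<length vs - 1. P (node_agent G (vs ! k)) \<in> edge_prefs G (vs ! k, vs ! Suc k)"
    by blast
  have ne: "vs \<noteq> []" "last vs = v" using vs(1) by (simp_all add: root_path_def)
  have "P (node_agent G ((vs @ [w]) ! k)) \<in> edge_prefs G ((vs @ [w]) ! k, (vs @ [w]) ! Suc k)"
    if "k < length vs" for k
  proof (cases "k = length vs - 1")
    case True
    then show ?thesis using ne step.hyps by (auto simp: nth_append last_conv_nth)
  next
    case False
    then show ?thesis using vs(2) that by (auto simp: nth_append)
  qed
  moreover have "root_path (tree_edges G) (tree_root G) w (vs @ [w])"
    using vs(1) step.hyps(2) by (auto simp: root_path_def successively_append_iff)
  ultimately show ?case by (intro exI[of _ "vs @ [w]"]) simp
qed

text \<open>If the mover has moved before, her preference lies in the label of the edge she last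
  took, which the outgoing labels together exhaust; at her first move they exhaust her whole
  domain.\<close>

lemma ex_out_edge:
  assumes G: "is_mechanism N A a0 D G" and P: "P \<in> profiles N D"
    and v: "passes_through G P v" "v \<in> inner_nodes G"
  shows "\<exists>e\<in>out_edges G v. P (node_agent G v) \<in> edge_prefs G e"
proof -
  obtain vs where vs: "root_path (tree_edges G) (tree_root G) v vs"
    "\<forall>k<length vs - 1. P (node_agent G (vs ! k)) \<in> edge_prefs G (vs ! k, vs ! Suc k)"
    using passes_through_root_path[OF v(1)] by blast
  have ag: "node_agent G v \<in> N" using G v(2) by (simp add: is_mechanism_def)
  have un: "\<forall>k. previous_move G vs k \<longrightarrow>
           (\<Union>e\<in>out_edges G v. edge_prefs G e) = edge_prefs G (vs ! k, vs ! Suc k)"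
       "(\<nexists>k. previous_move G vs k) \<longrightarrow>
           (\<Union>e\<in>out_edges G v. edge_prefs G e) = D (node_agent G v)"
    using G v(2) vs(1) unfolding is_mechanism_def by blast+
  have "P (node_agent G v) \<in> (\<Union>e\<in>out_edges G v. edge_prefs G e)"
  proof (cases "\<exists>k. previous_move G vs k")
    case True
    then obtain k where k: "previous_move G vs k" by blast
    then have "P (node_agent G v) \<in> edge_prefs G (vs ! k, vs ! Suc k)"
      using vs by (auto simp: previous_move_def root_path_def)
    then show ?thesis using un(1) k by simp
  next
    case False
    then show ?thesis using un(2) P ag by auto
  qed
  then show ?thesis by blast
qed

lemma edge_prefs_disjoint:
  assumes "is_mechanism N A a0 D G" "e \<in> out_edges G v" "e' \<in> out_edges G v"
    "Q \<in> edge_prefs G e" "Q \<in> edge_prefs G e'"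
  shows "e = e'"
proof -
  have "\<forall>e\<in>tree_edges G. \<forall>e'\<in>tree_edges G.
      e \<noteq> e' \<and> fst e = fst e' \<longrightarrow> edge_prefs G e \<inter> edge_prefs G e' = {}"
    using assms(1) by (simp add: is_mechanism_def)
  then show ?thesis using assms(2-) unfolding out_edges_def by fastforce
qed

lemma not_diverge_refl:
  assumes "is_mechanism N A a0 D G"
  shows "\<not> diverge G v i Q Q"
  using edge_prefs_disjoint[OF assms] unfolding diverge_def by blast

text \<open>The profiles of \<open>S\<close> start together at the root and are never split, so by
  induction along the path of any one of them they visit the same nodes.\<close>

lemma induced_rule_const_if_pooled:
  assumes G: "is_mechanism N A a0 D G" and PQ: "P \<in> S" "Q \<in> S"
    and pooled: "\<And>v. v \<in> inner_nodes G \<Longrightarrow> \<forall>R\<in>S. passes_through G R v \<Longrightarrow>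
      \<exists>e\<in>out_edges G v. \<forall>R\<in>S. R (node_agent G v) \<in> edge_prefs G e"
  shows "induced_rule G P = induced_rule G Q"
proof -
  have "\<forall>R\<in>S. passes_through G R v" if "passes_through G P v" "P \<in> S" for P v
    using that(1)
  proof induction
    case root
    show ?case by (simp add: passes_through.root)
  next
    case (step v w)
    have vw: "(v, w) \<in> out_edges G v" using step.hyps(2) by (simp add: out_edges_def)
    have "v \<in> inner_nodes G"
      using passes_through_in_nodes[OF G step.hyps(1)] vw
      by (auto simp: inner_nodes_def tree_leaves_def)
    then obtain e where e: "e \<in> out_edges G v" "\<forall>R\<in>S. R (node_agent G v) \<in> edge_prefs G e"
      using pooled step.IH by blast
    \<comment> \<open>Labels at a node are disjoint, so the edge shared by \<open>S\<close> is the
      one that \<open>P\<close> follows.\<close>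
    have "e = (v, w)"
      using edge_prefs_disjoint[OF G e(1) vw _ step.hyps(3)] e(2) \<open>P \<in> S\<close> by blast
    then show ?case
      using e(2) step.IH step.hyps(2) by (auto intro: passes_through.step)
  qed
  \<comment> \<open>The leaf is described in terms of \<open>passes_through\<close>, so equal
    predicates give equal leaves.\<close>
  then have "passes_through G P = passes_through G Q" using PQ by blast
  then show ?thesis by (simp add: induced_rule_def)
qed

section \<open>FPTTC outcomes with at most two active agents\<close>

text \<open>Relational counterpart of \<open>best\<close> for prescribing rankings; applied to
  \<open>X\<close> without its top element it prescribes the second choice.\<close>

definition tops :: "'b set \<Rightarrow> 'b rel \<Rightarrow> 'b \<Rightarrow> bool" where
  "tops X r y \<longleftrightarrow> y \<in> X \<and> (\<forall>x\<in>X. x \<noteq> y \<longrightarrow> (y, x) \<in> r)"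

lemma tops_promote: "x \<in> X \<Longrightarrow> tops X (promote X x r) x"
  by (simp add: tops_def promote_def)

context fpttc_market
begin

lemma points_to_top:
  assumes "P k \<in> prefs" "tops (insert a0 A) (P k) y" "y \<in> B" "B \<subseteq> A"
  shows "points_to a0 prio P M B k = owner prio M y"
proof -
  have y: "y \<in> acceptable a0 (P k) B"
    using assms a0 by (auto simp: tops_def acceptable_def)
  moreover have "best (P k) (acceptable a0 (P k) B) = y"
    using y assms(2,4) by (intro best_eqI[OF assms(1)]) (auto simp: tops_def acceptable_def)
  ultimately show ?thesis by (auto simp: points_to_def)
qed

lemma points_to_none:
  assumes "P k \<in> prefs" "tops (insert a0 A) (P k) a0" "B \<subseteq> A"
  shows "points_to a0 prio P M B k = k"
proof -
  have "(x, a0) \<notin> P k" if "x \<in> B" for x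
  proof -
    have "x \<in> insert a0 A" "x \<noteq> a0" using that assms(3) a0 by auto
    then show ?thesis using assms(2) linorders_asym[OF assms(1), of a0 x] unfolding tops_def by blast
  qed
  then have "acceptable a0 (P k) B = {}" by (auto simp: acceptable_def)
  then show ?thesis by (simp add: points_to_def)
qed

text \<open>While \<open>j\<close> remains, \<open>i\<close> points to the owner of
  \<open>b\<close>. That owner is not \<open>i\<close>, as \<open>j\<close> has higher priority at
  \<open>b\<close>, and she is a sink: either \<open>j\<close> herself, who wants \<open>b\<close>,
  or an agent who accepts nothing. So \<open>i\<close> leaves only after \<open>j\<close> has taken
  \<open>b\<close>, and gets her second choice \<open>x\<close>, possibly \<open>a0\<close>.\<close>

lemma fpttc_blocked:
  assumes P: "\<And>k. k \<in> N \<Longrightarrow> P k \<in> prefs" and ij: "i \<in> N" "j \<in> N" "(j, i) \<in> prio b"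
    and b: "b \<in> A" and x: "x \<in> insert a0 A" "x \<noteq> b"
    and i: "tops (insert a0 A) (P i) b" "tops (insert a0 A - {b}) (P i) x"
    and j: "tops (insert a0 A) (P j) b"
    and others: "\<And>k. k \<in> N - {i, j} \<Longrightarrow> tops (insert a0 A) (P k) a0"
  shows "fpttc N A a0 prio P i = x"
proof -
  have ne: "i \<noteq> j" using ij prio[OF b] by (auto simp: linorders_iff irrefl_def)
  define \<nu> where "\<nu> k = (if k = i then x else if k = j then b else a0)" for k
  have "fpttc N A a0 prio P = restrict \<nu> N"
    using P
  proof (rule fpttc_eqI)
    show "\<nu> \<in> N \<rightarrow> insert a0 A" using x b by (auto simp: \<nu>_def)
    show "k = l" if "\<nu> k = \<nu> l" "\<nu> k \<in> A" for k l
      using that x a0 ne by (auto simp: \<nu>_def split: if_splits)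
  next
    fix M B k
    assume M: "M \<subseteq> N" and B: "B = A - \<nu> ` (N - M)" "\<nu> ` M \<subseteq> insert a0 B"
      and k: "k \<in> M" "k \<in> in_cycle a0 prio P M B"
    have finM: "finite M" using M finN by (rule finite_subset)
    have BA: "B \<subseteq> A" using B(1) by blast
    have kB: "\<nu> k \<in> insert a0 B" using B(2) k(1) by blast
    have Pk: "P k \<in> prefs" using P k(1) M by blast
    show "best (P k) (insert a0 B) = \<nu> k"
    proof (cases "k = i")
      case False
      then have "tops (insert a0 A) (P k) (\<nu> k)" using j others k(1) M by (auto simp: \<nu>_def)
      then show ?thesis using kB BA by (intro best_eqI[OF Pk]) (auto simp: tops_def)
    next
      case True
      have "j \<notin> M"
      proof
        assume jM: "j \<in> M"
        have "\<nu> j = b" using ne by (simp add: \<nu>_def)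
        then have bB: "b \<in> B" using B(2) jM b a0 by auto
        let ?o = "owner prio M b"
        have o: "?o \<in> M" using owner_in b M jM by blast
        have "?o \<noteq> i"
        proof
          assume "?o = i"
          then have "(i, j) \<in> prio b"
            using best_above[OF prio[OF b] finM _ M jM] jM ne by (auto simp: owner_def)
          then show False using linorders_asym[OF prio[OF b]] ij(3) by blast
        qed
        moreover have "points_to a0 prio P M B i = ?o"
          using points_to_top[of P i b B M] P ij i bB BA by blast
        moreover have "points_to a0 prio P M B ?o = ?o"
        proof (cases "?o = j")
          case True
          then show ?thesis using points_to_top[of P j b B M] P ij j bB BA by simp
        next
          case False
          then show ?thesis
            using points_to_none[of P ?o B M] P others[of ?o] o M \<open>?o \<noteq> i\<close> BA by blast
        qed
        ultimately have "i \<notin> in_cycle a0 prio P M B" by (intro not_in_cycle_if_sink)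
        then show False using k(2) True by blast
      qed
      then have "b = \<nu> j" "j \<in> N - M" using ne ij by (simp_all add: \<nu>_def)
      then have "b \<notin> B" using B(1) by blast
      then show ?thesis
        using kB BA i(2) True a0 b by (intro best_eqI[OF Pk]) (auto simp: tops_def \<nu>_def)
    qed
  qed
  then show ?thesis using ij by (simp add: \<nu>_def)
qed

lemma fpttc_two_top_choices:
  assumes P: "\<And>k. k \<in> N \<Longrightarrow> P k \<in> prefs" and ij: "i \<in> N" "j \<in> N" "i \<noteq> j"
    and xy: "x \<in> A" "y \<in> A" "x \<noteq> y"
    and "tops (insert a0 A) (P i) x" "tops (insert a0 A) (P j) y"
    and "\<And>k. k \<in> N - {i, j} \<Longrightarrow> tops (insert a0 A) (P k) a0"
  shows "fpttc N A a0 prio P i = x"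
proof -
  define \<nu> where "\<nu> k = (if k = i then x else if k = j then y else a0)" for k
  have top: "tops (insert a0 A) (P k) (\<nu> k)" if "k \<in> N" for k
    using assms that by (auto simp: \<nu>_def)
  have "fpttc N A a0 prio P = restrict \<nu> N"
    using P
  proof (rule fpttc_top_choices)
    show "\<nu> \<in> N \<rightarrow> insert a0 A" using xy by (auto simp: \<nu>_def)
    show "k = l" if "\<nu> k = \<nu> l" "\<nu> k \<in> A" for k l
      using that xy a0 by (auto simp: \<nu>_def split: if_splits)
    show "(\<nu> k, z) \<in> P k" if "k \<in> N" "z \<in> insert a0 A" "z \<noteq> \<nu> k" for k z
      using top[OF that(1)] that(2,3) by (auto simp: tops_def)
  qed
  then show ?thesis using ij by (simp add: \<nu>_def)
qed

section \<open>The profiles witnessing a priority conflict\<close>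

abbreviation raise :: "'a \<Rightarrow> 'a rel \<Rightarrow> 'a rel" where
  "raise \<equiv> promote (insert a0 A)"

text \<open>A product set, with \<open>q\<close> meant to rank \<open>a0\<close> first, so that
  \<open>raise\<close> lists exactly the acceptable objects. It is invariant under exchanging
  \<open>(i, a)\<close> with \<open>(j, b)\<close>, so one pooling argument serves both
  agents.\<close>

definition duel :: "'a rel \<Rightarrow> 'i \<Rightarrow> 'a \<Rightarrow> 'i \<Rightarrow> 'a \<Rightarrow> ('i, 'a) profile set" where
  "duel q i a j b = {P \<in> profiles N (full_domain A a0).
     P i \<in> {raise a (raise b q), raise b (raise a q), raise b q} \<and>
     P j \<in> {raise b (raise a q), raise a (raise b q), raise a q} \<and>
     (\<forall>k\<in>N - {i, j}. P k = q)}"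

lemma duel_sym: "duel q i a j b = duel q j b i a"
  by (auto simp: duel_def)

definition duel_profile :: "'a rel \<Rightarrow> 'i \<Rightarrow> 'a rel \<Rightarrow> 'i \<Rightarrow> 'a rel \<Rightarrow> ('i, 'a) profile" where
  "duel_profile q i Qi j Qj = (\<lambda>k\<in>N. if k = i then Qi else if k = j then Qj else q)"

context
  fixes i j :: 'i and a b :: 'a and q :: "'a rel"
  assumes ij: "i \<in> N" "j \<in> N" and ab: "a \<in> A" "b \<in> A"
    and q: "q \<in> prefs" "tops (insert a0 A) q a0"
    and conflict: "(i, j) \<in> prio a" "(j, i) \<in> prio b"
begin

lemma duel_distinct: "i \<noteq> j" "a \<noteq> b" "a \<noteq> a0" "b \<noteq> a0"
  using conflict linorders_asym[OF prio] prio[OF ab(1)] ab a0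
  by (auto simp: linorders_iff irrefl_def)

lemma duel_prefs:
  "raise a q \<in> prefs" "raise b q \<in> prefs"
  "raise a (raise b q) \<in> prefs" "raise b (raise a q) \<in> prefs"
  using q ab by (simp_all add: promote_linorders)

lemma duel_profile_in:
  assumes "Qi \<in> {raise a (raise b q), raise b (raise a q), raise b q}"
    "Qj \<in> {raise b (raise a q), raise a (raise b q), raise a q}"
  shows "duel_profile q i Qi j Qj \<in> duel q i a j b"
  using assms duel_prefs q duel_distinct ij
  by (auto simp: duel_def duel_profile_def full_domain_def)

text \<open>In the first and third profile \<open>i\<close> and \<open>j\<close> have different
  favourites and both get them. In the other two both want \<open>b\<close>, where \<open>j\<close>
  has priority, so \<open>i\<close> falls back on \<open>a\<close> or on \<open>a0\<close>.\<close>

lemma duel_outcomes: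
  shows "fpttc N A a0 prio (duel_profile q i (raise a (raise b q)) j (raise b (raise a q))) i = a"
    and "fpttc N A a0 prio (duel_profile q i (raise b (raise a q)) j (raise b (raise a q))) i = a"
    and "fpttc N A a0 prio (duel_profile q i (raise b q) j (raise a (raise b q))) i = b"
    and "fpttc N A a0 prio (duel_profile q i (raise b q) j (raise b (raise a q))) i = a0"
proof -
  have top: "tops (insert a0 A) (raise x r) x" if "x \<in> A" for x r
    using that by (simp add: tops_promote)
  have second: "tops (insert a0 A - {b}) (raise b (raise a q)) a"
    "tops (insert a0 A - {b}) (raise b q) a0"
    using ab duel_distinct q(2) by (auto simp: tops_def promote_def)
  have app: "duel_profile q i Qi j Qj i = Qi" "duel_profile q i Qi j Qj j = Qj"
    "k \<in> N - {i, j} \<Longrightarrow> duel_profile q i Qi j Qj k = q" for Qi Qj k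
    using ij duel_distinct by (auto simp: duel_profile_def)
  have mem: "duel_profile q i Qi j Qj k \<in> prefs" if "Qi \<in> prefs" "Qj \<in> prefs" "k \<in> N" for Qi Qj k
    using that q by (simp add: duel_profile_def)
  show "fpttc N A a0 prio (duel_profile q i (raise a (raise b q)) j (raise b (raise a q))) i = a"
    by (rule fpttc_two_top_choices[of _ i j a b])
      (use mem duel_prefs ij ab duel_distinct in \<open>auto simp: app top q\<close>)
  show "fpttc N A a0 prio (duel_profile q i (raise b (raise a q)) j (raise b (raise a q))) i = a"
    by (rule fpttc_blocked[of _ i j b a])
      (use mem duel_prefs ij ab conflict duel_distinct in \<open>auto simp: app top q second\<close>)
  show "fpttc N A a0 prio (duel_profile q i (raise b q) j (raise a (raise b q))) i = b"
    by (rule fpttc_two_top_choices[of _ i j b a])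
      (use mem duel_prefs ij ab duel_distinct in \<open>auto simp: app top q\<close>)
  show "fpttc N A a0 prio (duel_profile q i (raise b q) j (raise b (raise a q))) i = a0"
    by (rule fpttc_blocked[of _ i j b a0])
      (use mem duel_prefs ij ab conflict duel_distinct in \<open>auto simp: app top q second\<close>)
qed

lemma duel_pooled:
  assumes G: "is_mechanism N A a0 (full_domain A a0) G" and S: "SOSP N (full_domain A a0) G"
    and rule: "\<forall>P\<in>profiles N (full_domain A a0). fpttc N A a0 prio P = induced_rule G P"
    and v: "v \<in> inner_nodes G" "node_agent G v = i"
      "\<forall>P\<in>duel q i a j b. passes_through G P v"
  shows "\<exists>e\<in>out_edges G v. \<forall>P\<in>duel q i a j b. P i \<in> edge_prefs G e"
proof -
  let ?ab = "raise a (raise b q)" and ?ba = "raise b (raise a q)" and ?b = "raise b q"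
  let ?P1 = "duel_profile q i ?ba j ?ba" and ?P2 = "duel_profile q i ?b j ?ab"
    and ?P3 = "duel_profile q i ?b j ?ba" and ?P4 = "duel_profile q i ?ab j ?ba"
  have mem: "?P1 \<in> duel q i a j b" "?P2 \<in> duel q i a j b"
    "?P3 \<in> duel q i a j b" "?P4 \<in> duel q i a j b"
    by (simp_all add: duel_profile_in)
  have dom: "P \<in> profiles N (full_domain A a0)" if "P \<in> duel q i a j b" for P
    using that by (simp add: duel_def)
  have app: "duel_profile q i Qi j Qj i = Qi" for Qi Qj
    using ij by (simp add: duel_profile_def)
  have sosp: "weakly_prefers (P i) (fpttc N A a0 prio P' i) (fpttc N A a0 prio Pt i)"
    if "P \<in> duel q i a j b" "P' \<in> duel q i a j b" "Pt \<in> duel q i a j b"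
      "\<not> diverge G v i (P i) (P' i)" "diverge G v i (P i) (Pt i)" for P P' Pt
    using S v ij(1) that dom[OF that(1)] dom[OF that(2)] dom[OF that(3)] rule
    unfolding SOSP_def by metis
  have nd_b: "\<not> diverge G v i ?ba ?b"
  proof
    assume "diverge G v i ?ba ?b"
    then have "weakly_prefers ?ba a b"
      using sosp[OF mem(1,1,2)] not_diverge_refl[OF G] by (simp add: app duel_outcomes)
    then show False using duel_distinct by (auto simp: promote_def)
  qed
  have "\<not> diverge G v i ?ba ?ab"
  proof
    assume "diverge G v i ?ba ?ab"
    then have "weakly_prefers ?ba a0 a"
      using sosp[OF mem(1,3,4)] nd_b by (simp add: app duel_outcomes)
    then show False using duel_distinct by (auto simp: promote_def)
  qed
  moreover have "\<not> diverge G v i ?ba ?ba" by (rule not_diverge_refl[OF G])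
  ultimately have nd: "\<not> diverge G v i ?ba (P i)" if "P \<in> duel q i a j b" for P
    using that nd_b by (auto simp: duel_def)
  \<comment> \<open>Non-divergence also holds for a preference lying on no edge, so coverage is what
    turns it into sharing an edge.\<close>
  have cover: "\<exists>e\<in>out_edges G v. P i \<in> edge_prefs G e" if "P \<in> duel q i a j b" for P
    using ex_out_edge[OF G dom[OF that]] v that by blast
  obtain e where e: "e \<in> out_edges G v" "?ba \<in> edge_prefs G e"
    using cover[OF mem(1)] by (auto simp: app)
  have "P i \<in> edge_prefs G e" if P: "P \<in> duel q i a j b" for P
  proof -
    obtain e' where "e' \<in> out_edges G v" "P i \<in> edge_prefs G e'" using cover[OF P] by blast
    then show ?thesis using nd[OF P] e v(2) unfolding diverge_def by metis
  qed
  then show ?thesis using e(1) by blast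
qed

end

section \<open>SOSP implementation forces equal priorities\<close>

lemma no_conflict_if_SOSP_implementable:
  assumes impl: "SOSP_implementable N A a0 (full_domain A a0) (fpttc N A a0 prio)"
    and ij: "i \<in> N" "j \<in> N" and ab: "a \<in> A" "b \<in> A"
    and c: "(i, j) \<in> prio a" "(j, i) \<in> prio b"
  shows False
proof -
  obtain G :: "(nat, 'i, 'a) mechanism" where
    G: "is_mechanism N A a0 (full_domain A a0) G" and S: "SOSP N (full_domain A a0) G"
    and rule: "\<forall>P\<in>profiles N (full_domain A a0). fpttc N A a0 prio P = induced_rule G P"
    using impl unfolding SOSP_implementable_def by blast
  obtain r0 where r0: "r0 \<in> prefs" using ex_linorder finA by blast
  \<comment> \<open>Any order with \<open>a0\<close> moved to the top serves as the ranking of an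
    agent who accepts nothing.\<close>
  define q where "q = raise a0 r0"
  have q: "q \<in> prefs" "tops (insert a0 A) q a0"
    using r0 by (simp_all add: q_def promote_linorders tops_promote)
  let ?S = "duel q i a j b"
  let ?P = "duel_profile q i (raise a (raise b q)) j (raise b (raise a q))"
    and ?Q = "duel_profile q i (raise b q) j (raise a (raise b q))"
  have mem: "?P \<in> ?S" "?Q \<in> ?S"
    by (simp_all add: duel_profile_in[OF ij ab q c])
  have dom: "?P \<in> profiles N (full_domain A a0)" "?Q \<in> profiles N (full_domain A a0)"
    using mem by (simp_all add: duel_def)
  have "induced_rule G ?P = induced_rule G ?Q"
    using G mem
  proof (rule induced_rule_const_if_pooled)
    fix v assume v: "v \<in> inner_nodes G" "\<forall>R\<in>?S. passes_through G R v"
    have k: "node_agent G v \<in> N" using G v(1) by (simp add: is_mechanism_def)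
    consider "node_agent G v = i" | "node_agent G v = j" | "node_agent G v \<in> N - {i, j}"
      using k by blast
    then show "\<exists>e\<in>out_edges G v. \<forall>R\<in>?S. R (node_agent G v) \<in> edge_prefs G e"
    proof cases
      case 1
      then show ?thesis using duel_pooled[OF ij ab q c G S rule v(1)] v(2) by simp
    next
      case 2
      \<comment> \<open>The pooling argument for \<open>j\<close> is the one for \<open>i\<close>
        with agents and objects exchanged.\<close>
      then show ?thesis
        using duel_pooled[OF ij(2,1) ab(2,1) q c(2,1) G S rule v(1)] v(2)
        by (simp add: duel_sym[of q i])
    next
      case 3
      then have eq: "R (node_agent G v) = q" if "R \<in> ?S" for R
        using that by (simp add: duel_def)
      obtain e where e: "e \<in> out_edges G v" "?P (node_agent G v) \<in> edge_prefs G e"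
        using ex_out_edge[OF G dom(1) bspec[OF v(2) mem(1)] v(1)] by (rule bexE)
      have "R (node_agent G v) \<in> edge_prefs G e" if "R \<in> ?S" for R
        using e(2) unfolding eq[OF that] eq[OF mem(1)] .
      then show ?thesis using e(1) by (intro bexI[of _ e] ballI)
    qed
  qed
  \<comment> \<open>Yet \<open>i\<close> gets \<open>a\<close> at \<open>?P\<close> and
    \<open>b\<close> at \<open>?Q\<close>.\<close>
  then have "fpttc N A a0 prio ?P i = fpttc N A a0 prio ?Q i" using rule dom by simp
  then show False
    using duel_outcomes(1,3)[OF ij ab q c] duel_distinct(2)[OF ij ab q c] by simp
qed

lemma common_priority_if_SOSP_implementable:
  assumes impl: "SOSP_implementable N A a0 (full_domain A a0) (fpttc N A a0 prio)"
    and ab: "a \<in> A" "b \<in> A"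
  shows "prio a = prio b"
proof -
  have "prio x \<subseteq> prio y" if "x \<in> A" "y \<in> A" for x y
  proof (rule subrelI)
    fix i j assume c: "(i, j) \<in> prio x"
    then have "i \<in> N" "j \<in> N" "i \<noteq> j"
      using prio[OF that(1)] by (auto simp: linorders_iff irrefl_def)
    then show "(i, j) \<in> prio y"
      using no_conflict_if_SOSP_implementable[OF impl _ _ that c] linorders_total[OF prio[OF that(2)]]
      by blast
  qed
  then show ?thesis using ab by blast
qed

end


section \<open>Serial dictatorships as mechanisms\<close>

lemma root_path_Nil: "\<not> root_path E r v []"
  by (simp add: root_path_def)

lemma root_path_snoc:
  "root_path E r v (ws @ [w]) \<longleftrightarrow>
     w = v \<and> (ws = [] \<and> v = r \<or> root_path E r (last ws) ws \<and> (last ws, v) \<in> E)"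
  by (cases "ws = []") (auto simp: root_path_def successively_append_iff)

text \<open>A walk can be traced backwards in only one way, and the decreasing depth makes the
  tracing end, necessarily at the root. As no edge enters the root, its only walk is the trivial
  one.\<close>

lemma rooted_treeI:
  fixes depth :: "'v \<Rightarrow> nat"
  assumes fin: "finite V" and r: "r \<in> V" "\<And>u. (u, r) \<notin> E" and E: "E \<subseteq> V \<times> V"
    and parent: "\<And>v. v \<in> V \<Longrightarrow> v \<noteq> r \<Longrightarrow> \<exists>!u. (u, v) \<in> E"
    and depth: "\<And>u v. (u, v) \<in> E \<Longrightarrow> depth u < depth v"
  shows "rooted_tree V E r"
proof -
  have ex1: "\<exists>!vs. root_path E r v vs" if "v \<in> V" for v
    using that
  proof (induction "depth v" arbitrary: v rule: less_induct)
    case less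
    show ?case
    proof (cases "v = r")
      case True
      have "root_path E r v [r]" using True by (simp add: root_path_def)
      moreover have "vs = [r]" if "root_path E r v vs" for vs
        using that r(2) True
        by (cases vs rule: rev_cases) (auto simp: root_path_snoc root_path_Nil)
      ultimately show ?thesis by (rule ex1I)
    next
      case False
      then obtain u where u: "(u, v) \<in> E" "\<And>u'. (u', v) \<in> E \<Longrightarrow> u' = u"
        using parent[OF less.prems] by blast
      have "u \<in> V" using u(1) E by blast
      then obtain us where us: "root_path E r u us" "\<And>us'. root_path E r u us' \<Longrightarrow> us' = us"
        using less.hyps[OF depth[OF u(1)]] by blast
      have "last us = u" using us(1) by (simp add: root_path_def)
      then have "root_path E r v (us @ [v])" using us(1) u(1) by (simp add: root_path_snoc)
      moreover have "vs = us @ [v]" if "root_path E r v vs" for vs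
        using that u(2) us(2) False
        by (cases vs rule: rev_cases) (auto simp: root_path_snoc root_path_Nil)
      ultimately show ?thesis by (rule ex1I)
    qed
  qed
  show ?thesis unfolding rooted_tree_def using fin r(1) E ex1 by blast
qed

text \<open>In the order \<open>r\<close>, enumerated by \<open>\<sigma>\<close>, every agent reveals her whole preference. A node is
  the encoded list of the numbers (under \<open>q\<close>) of the preferences revealed so far.\<close>

locale revelation =
  fixes N :: "'i set" and A :: "'a set" and a0 :: 'a and r :: "'i rel"
    and f :: "('i, 'a) profile \<Rightarrow> ('i, 'a) allocation"
    and \<sigma> :: "nat \<Rightarrow> 'i" and q :: "nat \<Rightarrow> 'a rel" and n m :: nat
  assumes A: "finite A" and r: "r \<in> linorders N"
    and serial: "\<And>P i. P \<in> profiles N (full_domain A a0) \<Longrightarrow> i \<in> N \<Longrightarrow>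
      f P i = best (P i) (insert a0 (A - f P ` {j \<in> N. (j, i) \<in> r}))"
    and f: "\<And>P. P \<in> profiles N (full_domain A a0) \<Longrightarrow> f P \<in> allocations N A a0"
    and \<sigma>: "bij_betw \<sigma> {..<n} N" and \<sigma>_less: "\<And>s t. s < t \<Longrightarrow> t < n \<Longrightarrow> (\<sigma> s, \<sigma> t) \<in> r"
    and q: "bij_betw q {..<m} (linorders (insert a0 A))"
begin

abbreviation dom :: "('i, 'a) profile set" where
  "dom \<equiv> profiles N (full_domain A a0)"

definition nodes :: "nat set" where
  "nodes = {v. set (list_decode v) \<subseteq> {..<m} \<and> length (list_decode v) \<le> n}"

definition edges :: "(nat \<times> nat) set" where
  "edges = {(v, w). v \<in> nodes \<and> w \<in> nodes \<and> (\<exists>c. list_decode w = list_decode v @ [c])}"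

text \<open>An edge carries the single preference numbered by the entry it appends, and depth
  determines the mover. A leaf holds one number per agent, so the whole profile can be read back and
  \<open>f\<close> evaluated there.\<close>

definition mech :: "(nat, 'i, 'a) mechanism" where
  "mech = \<lparr>tree_nodes = nodes, tree_edges = edges, tree_root = list_encode [],
     leaf_alloc = (\<lambda>v. f (\<lambda>i\<in>N. q (list_decode v ! inv_into {..<n} \<sigma> i))),
     node_agent = (\<lambda>v. \<sigma> (length (list_decode v))),
     edge_prefs = (\<lambda>(v, w). {q (last (list_decode w))})\<rparr>"

lemma mech_simps [simp]:
  "tree_nodes mech = nodes" "tree_edges mech = edges" "tree_root mech = list_encode []"
  "node_agent mech v = \<sigma> (length (list_decode v))"
  "edge_prefs mech (v, w) = {q (last (list_decode w))}"
  by (simp_all add: mech_def)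

text \<open>The node that \<open>P\<close> reaches after the first \<open>p\<close> agents have
  moved.\<close>

definition code :: "('i, 'a) profile \<Rightarrow> nat \<Rightarrow> nat" where
  "code P p = list_encode (map (\<lambda>s. inv_into {..<m} q (P (\<sigma> s))) [0..<p])"

lemma decode_code [simp]:
  "list_decode (code P p) = map (\<lambda>s. inv_into {..<m} q (P (\<sigma> s))) [0..<p]"
  by (simp add: code_def)

lemma \<sigma>_in: "p < n \<Longrightarrow> \<sigma> p \<in> N"
  using \<sigma> by (auto simp: bij_betw_def)

lemma agent_at:
  assumes "i \<in> N"
  shows "\<exists>p<n. i = \<sigma> p"
  using assms \<sigma> by (auto simp: bij_betw_def)

lemma pref_in: "P \<in> dom \<Longrightarrow> i \<in> N \<Longrightarrow> P i \<in> linorders (insert a0 A)"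
  by (auto simp: full_domain_def)

lemma q_inv:
  assumes "P \<in> dom" "p < n"
  shows "inv_into {..<m} q (P (\<sigma> p)) < m" "q (inv_into {..<m} q (P (\<sigma> p))) = P (\<sigma> p)"
proof -
  have "P (\<sigma> p) \<in> q ` {..<m}"
    using pref_in[OF assms(1) \<sigma>_in[OF assms(2)]] q by (simp add: bij_betw_def)
  then show "inv_into {..<m} q (P (\<sigma> p)) < m" "q (inv_into {..<m} q (P (\<sigma> p))) = P (\<sigma> p)"
    using inv_into_into[of "P (\<sigma> p)" q "{..<m}"] f_inv_into_f[of "P (\<sigma> p)" q "{..<m}"] by simp_all
qed

lemma code_in: "P \<in> dom \<Longrightarrow> p \<le> n \<Longrightarrow> code P p \<in> nodes"
  using q_inv by (auto simp: nodes_def)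

lemma code_edge: "P \<in> dom \<Longrightarrow> p < n \<Longrightarrow> (code P p, code P (Suc p)) \<in> edges"
  using code_in by (simp add: edges_def)

lemma passes_through_iff:
  assumes P: "P \<in> dom"
  shows "passes_through mech P v \<longleftrightarrow> (\<exists>p\<le>n. v = code P p)"
proof
  assume "passes_through mech P v"
  then show "\<exists>p\<le>n. v = code P p"
  proof induction
    case root
    then show ?case by (intro exI[of _ 0]) (simp add: code_def)
  next
    case (step v w)
    then obtain p where p: "p \<le> n" "v = code P p" by blast
    obtain c where c: "w \<in> nodes" "list_decode w = list_decode v @ [c]"
      using step.hyps(2) by (auto simp: edges_def)
    have pn: "p < n" and cm: "c < m" using c p by (auto simp: nodes_def)
    have "q c = P (\<sigma> p)" using step.hyps(3) c(2) p by simp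
    \<comment> \<open>Injectivity of \<open>q\<close> leaves only one child whose label contains the
      mover's preference.\<close>
    then have "c = inv_into {..<m} q (P (\<sigma> p))"
      using q cm inv_into_f_f[of q "{..<m}" c] by (simp add: bij_betw_def)
    then have "list_decode w = list_decode (code P (Suc p))" using c(2) p(2) by simp
    then have "w = code P (Suc p)" by (metis list_decode_inverse)
    then show ?case using pn by (intro exI[of _ "Suc p"]) simp
  qed
next
  have "passes_through mech P (code P p)" if "p \<le> n" for p
    using that
  proof (induction p)
    case 0
    then show ?case using passes_through.root[of mech P] by (simp add: code_def)
  next
    case (Suc p)
    then have "passes_through mech P (code P p)" by simp
    moreover have "(code P p, code P (Suc p)) \<in> tree_edges mech"
      using code_edge[OF P, of p] Suc.prems by simp
    moreover have "P (node_agent mech (code P p)) \<in> edge_prefs mech (code P p, code P (Suc p))"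
      using q_inv(2)[OF P, of p] Suc.prems by simp
    ultimately show ?case by (rule passes_through.step)
  qed
  then show "\<exists>p\<le>n. v = code P p \<Longrightarrow> passes_through mech P v" by blast
qed

text \<open>Guarantees a child for every list shorter than \<open>n\<close>, so that the leaves are
  exactly the lists of length \<open>n\<close>.\<close>

lemma q_nonempty: "0 < m"
proof -
  have "linorders (insert a0 A) \<noteq> {}" using ex_linorder[of "insert a0 A"] A by auto
  then show ?thesis using q by (auto simp: bij_betw_def)
qed

lemma edge_snoc:
  assumes "v \<in> nodes" "length (list_decode v) < n" "c < m"
  shows "(v, list_encode (list_decode v @ [c])) \<in> edges"
  using assms by (simp add: edges_def nodes_def)

lemma leaves: "tree_leaves mech = {v \<in> nodes. length (list_decode v) = n}"
proof -
  have "out_edges mech v = {} \<longleftrightarrow> length (list_decode v) = n" if "v \<in> nodes" for v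
  proof
    assume "out_edges mech v = {}"
    then have "\<not> length (list_decode v) < n"
      using edge_snoc[OF that _ q_nonempty] by (auto simp: out_edges_def)
    then show "length (list_decode v) = n" using that by (simp add: nodes_def)
  next
    assume "length (list_decode v) = n"
    then show "out_edges mech v = {}" by (auto simp: out_edges_def edges_def nodes_def)
  qed
  then show ?thesis by (auto simp: tree_leaves_def)
qed

lemma inner: "inner_nodes mech = {v \<in> nodes. length (list_decode v) < n}"
  by (auto simp: inner_nodes_def leaves nodes_def)

lemma leaf_alloc_code:
  assumes P: "P \<in> dom"
  shows "leaf_alloc mech (code P n) = f P"
proof -
  have "(\<lambda>i\<in>N. q (list_decode (code P n) ! inv_into {..<n} \<sigma> i)) = P"
  proof
    fix i show "(\<lambda>i\<in>N. q (list_decode (code P n) ! inv_into {..<n} \<sigma> i)) i = P i"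
    proof (cases "i \<in> N")
      case True
      then obtain p where p: "p < n" "i = \<sigma> p" using agent_at by blast
      have "inv_into {..<n} \<sigma> i = p"
        using p \<sigma> inv_into_f_f[of \<sigma> "{..<n}" p] by (simp add: bij_betw_def)
      then show ?thesis using True p q_inv(2)[OF P] by simp
    next
      case False
      then show ?thesis using P by (auto simp: PiE_def extensional_def)
    qed
  qed
  then show ?thesis by (simp add: mech_def)
qed

lemma induced: "P \<in> dom \<Longrightarrow> induced_rule mech P = f P"
proof -
  assume P: "P \<in> dom"
  have "(THE l. l \<in> tree_leaves mech \<and> passes_through mech P l) = code P n"
    using P code_in[OF P] by (intro the_equality) (auto simp: leaves passes_through_iff)
  then show ?thesis using leaf_alloc_code[OF P] by (simp add: induced_rule_def)
qed

lemma root_path_depth: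
  assumes "root_path edges (list_encode []) v vs" "k < length vs"
  shows "length (list_decode (vs ! k)) = k"
  using assms(2)
proof (induction k)
  case 0
  then show ?case using assms(1) by (auto simp: root_path_def hd_conv_nth)
next
  case (Suc k)
  have "(vs ! k, vs ! Suc k) \<in> edges"
    using assms(1) Suc.prems by (auto simp: root_path_def successively_conv_nth)
  then show ?case using Suc by (auto simp: edges_def)
qed

text \<open>The position of a node on its path is its depth, and \<open>\<sigma>\<close> assigns
  different agents to different depths. Hence every move is a first move, and the outgoing labels
  have to cover the full domain.\<close>

lemma no_previous_move:
  assumes v: "v \<in> inner_nodes mech" and vs: "root_path edges (list_encode []) v vs"
  shows "\<not> previous_move mech vs k"
proof
  assume k: "previous_move mech vs k"
  have last: "last vs = v" "vs \<noteq> []" using vs by (simp_all add: root_path_def)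
  have "length (list_decode v) = length vs - 1"
    using root_path_depth[OF vs, of "length vs - 1"] last by (simp add: last_conv_nth)
  moreover have "k < length vs" using k by (auto simp: previous_move_def)
  then have "length (list_decode (vs ! k)) = k" by (rule root_path_depth[OF vs])
  moreover have "length (list_decode v) < n" using v by (simp add: inner)
  ultimately have "k < length vs - 1" "length vs - 1 < n" "\<sigma> k = \<sigma> (length vs - 1)"
    using k last by (auto simp: previous_move_def)
  then show False using \<sigma> inj_onD[of \<sigma> "{..<n}" k "length vs - 1"] by (auto simp: bij_betw_def)
qed

lemma tree: "rooted_tree nodes edges (list_encode [])"
proof (rule rooted_treeI[where depth = "\<lambda>v. length (list_decode v)"])
  have "nodes = list_encode ` {xs. set xs \<subseteq> {..<m} \<and> length xs \<le> n}"
    unfolding nodes_def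
    by (auto simp: image_iff) (metis list_decode_inverse)
  then show "finite nodes" by (simp add: finite_lists_length_le)
  show "list_encode [] \<in> nodes" by (simp add: nodes_def del: list_encode.simps)
  show "(u, list_encode []) \<notin> edges" for u
    by (simp add: edges_def del: list_encode.simps)
  show "edges \<subseteq> nodes \<times> nodes" by (auto simp: edges_def)
  show "length (list_decode u) < length (list_decode v)" if "(u, v) \<in> edges" for u v
    using that by (auto simp: edges_def)
  show "\<exists>!u. (u, v) \<in> edges" if v: "v \<in> nodes" "v \<noteq> list_encode []" for v
  proof -
    have "list_decode v \<noteq> []" using v(2) list_decode_inverse by metis
    then obtain xs c where xs: "list_decode v = xs @ [c]" by (metis rev_exhaust)
    show ?thesis
    proof (rule ex1I)
      show "(list_encode xs, v) \<in> edges" using v xs by (simp add: edges_def nodes_def)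
      show "u = list_encode xs" if "(u, v) \<in> edges" for u
      proof -
        have "list_decode u = xs" using that xs by (auto simp: edges_def)
        then show ?thesis by (metis list_decode_inverse)
      qed
    qed
  qed
qed

lemma out_edges_prefs:
  assumes "v \<in> inner_nodes mech"
  shows "(\<Union>e\<in>out_edges mech v. edge_prefs mech e) = linorders (insert a0 A)"
proof -
  have "q ` {..<m} = linorders (insert a0 A)" using q by (simp add: bij_betw_def)
  moreover have "(\<Union>e\<in>out_edges mech v. edge_prefs mech e) = q ` {..<m}"
  proof (intro equalityI subsetI)
    fix Q assume "Q \<in> (\<Union>e\<in>out_edges mech v. edge_prefs mech e)"
    then obtain w where w: "(v, w) \<in> edges" "Q = q (last (list_decode w))"
      by (auto simp: out_edges_def)
    then show "Q \<in> q ` {..<m}" by (auto simp: edges_def nodes_def)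
  next
    fix Q assume "Q \<in> q ` {..<m}"
    then obtain c where c: "c < m" "Q = q c" by blast
    have "(v, list_encode (list_decode v @ [c])) \<in> out_edges mech v"
      using edge_snoc[OF _ _ c(1)] assms by (simp add: inner out_edges_def)
    moreover have "Q \<in> edge_prefs mech (v, list_encode (list_decode v @ [c]))"
      using c(2) by simp
    ultimately show "Q \<in> (\<Union>e\<in>out_edges mech v. edge_prefs mech e)" by (rule UN_I)
  qed
  ultimately show ?thesis by simp
qed

lemma leaf_alloc_in:
  assumes "l \<in> tree_leaves mech"
  shows "leaf_alloc mech l \<in> allocations N A a0"
proof -
  have l: "set (list_decode l) \<subseteq> {..<m}" "length (list_decode l) = n"
    using assms by (auto simp: leaves nodes_def)
  have "q (list_decode l ! inv_into {..<n} \<sigma> i) \<in> linorders (insert a0 A)" if "i \<in> N" for i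
  proof -
    have "inv_into {..<n} \<sigma> i < n"
      using that \<sigma> inv_into_into[of i \<sigma> "{..<n}"] by (auto simp: bij_betw_def)
    then have "list_decode l ! inv_into {..<n} \<sigma> i \<in> {..<m}" using l nth_mem by blast
    then show ?thesis using q by (auto simp: bij_betw_def)
  qed
  then show ?thesis by (auto simp: mech_def full_domain_def intro!: f)
qed

lemma edges_same_pref:
  assumes "(v, w) \<in> edges" "(v, w') \<in> edges"
    "q (last (list_decode w)) = q (last (list_decode w'))"
  shows "w = w'"
proof -
  obtain c c' where c: "list_decode w = list_decode v @ [c]" "list_decode w' = list_decode v @ [c']"
    "c < m" "c' < m"
    using assms(1,2) by (auto simp: edges_def nodes_def)
  then have "c = c'" using assms(3) q inj_onD[of q "{..<m}" c c'] by (simp add: bij_betw_def)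
  then show ?thesis using c by (metis list_decode_inverse)
qed

lemma mechanism: "is_mechanism N A a0 (full_domain A a0) mech"
proof -
  have "edge_prefs mech e \<inter> edge_prefs mech e' = {}"
    if "e \<in> edges" "e' \<in> edges" "e \<noteq> e'" "fst e = fst e'" for e e'
    using that edges_same_pref by (cases e; cases e') auto
  moreover have "edge_prefs mech e \<subseteq> linorders (insert a0 A) \<and> edge_prefs mech e \<noteq> {}"
    if "e \<in> edges" for e
    using that q by (cases e) (auto simp: edges_def nodes_def bij_betw_def)
  moreover have "node_agent mech v \<in> N" if "v \<in> inner_nodes mech" for v
    using that \<sigma>_in by (simp add: inner)
  ultimately show ?thesis
    unfolding is_mechanism_def
    using tree leaf_alloc_in no_previous_move out_edges_prefs by (simp add: full_domain_def)
qed

section \<open>Incentives in the revelation mechanism\<close>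

text \<open>The agents preceding \<open>\<sigma> s\<close> are \<open>\<sigma> t\<close> with
  \<open>t < s\<close>; by induction they take the same objects at both profiles, so
  \<open>\<sigma> s\<close> faces the same menu with the same preference.\<close>

lemma serial_determined:
  assumes P: "P \<in> dom" "P' \<in> dom" and eq: "\<And>t. t \<le> s \<Longrightarrow> P (\<sigma> t) = P' (\<sigma> t)" and s: "s < n"
  shows "f P (\<sigma> s) = f P' (\<sigma> s)"
  using eq s
proof (induction s rule: less_induct)
  case (less s)
  have "f P ` {j \<in> N. (j, \<sigma> s) \<in> r} = f P' ` {j \<in> N. (j, \<sigma> s) \<in> r}"
  proof (rule image_cong)
    fix j assume "j \<in> {j \<in> N. (j, \<sigma> s) \<in> r}"
    then obtain t where t: "t < n" "j = \<sigma> t" "(\<sigma> t, \<sigma> s) \<in> r" using agent_at by blast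
    have "\<not> s < t" using \<sigma>_less[of s t] t linorders_asym[OF r] by blast
    moreover have "t \<noteq> s" using t(3) r by (auto simp: linorders_iff irrefl_def)
    ultimately have "t < s" by simp
    then show "f P j = f P' j" using less t(2) by simp
  qed simp
  then show ?case using serial P \<sigma>_in less.prems by simp
qed

text \<open>The node \<open>v\<close> fixes all earlier reports and hence the menu of
  \<open>i\<close>. Reporting truthfully yields the best element of this menu, any other report some
  element of it.\<close>

lemma SOSP_mech: "SOSP N (full_domain A a0) mech"
  unfolding SOSP_def
proof (intro ballI impI, elim conjE)
  fix i v P P' Pt
  assume v: "v \<in> inner_nodes mech" "node_agent mech v = i"
    and dom: "P \<in> dom" "P' \<in> dom" "Pt \<in> dom"
    and pass: "passes_through mech P v" "passes_through mech P' v" "passes_through mech Pt v"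
    and nd: "\<not> diverge mech v i (P i) (P' i)"
  define p where "p = length (list_decode v)"
  have p: "p < n" using v(1) by (simp add: inner p_def)
  have i: "i = \<sigma> p" "i \<in> N" using v(2) \<sigma>_in[OF p] by (simp_all add: p_def)
  have codes: "v = code P p" "v = code P' p" "v = code Pt p"
    using pass dom by (fastforce simp: passes_through_iff p_def)+
  have agree: "R (\<sigma> t) = R' (\<sigma> t)"
    if "code R p = code R' p" "R \<in> dom" "R' \<in> dom" "t < p" for R R' t
  proof -
    have tn: "t < n" using that(4) p by simp
    have "list_decode (code R p) ! t = list_decode (code R' p) ! t"
      by (simp only: that(1))
    then have "inv_into {..<m} q (R (\<sigma> t)) = inv_into {..<m} q (R' (\<sigma> t))"
      using that(4) by simp
    then show ?thesis using q_inv(2)[OF that(2) tn] q_inv(2)[OF that(3) tn] by metis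
  qed
  have step: "(v, code R (Suc p)) \<in> out_edges mech v" "R i \<in> edge_prefs mech (v, code R (Suc p))"
    if "R \<in> dom" "v = code R p" for R
    using code_edge[OF that(1) p] q_inv(2)[OF that(1) p] that(2) i(1)
    by (simp_all add: out_edges_def)
  \<comment> \<open>Labels are singletons, so not diverging at \<open>v\<close> amounts to
    \<open>P i = P' i\<close>.\<close>
  have "(v, code P (Suc p)) = (v, code P' (Suc p))"
    using nd step[OF dom(1) codes(1)] step[OF dom(2) codes(2)] v(2) unfolding diverge_def by blast
  then have "list_decode (code P (Suc p)) = list_decode (code P' (Suc p))" by simp
  then have "inv_into {..<m} q (P (\<sigma> p)) = inv_into {..<m} q (P' (\<sigma> p))" by simp
  then have Pi: "P i = P' i"
    using q_inv(2)[OF dom(1) p] q_inv(2)[OF dom(2) p] i(1) by metis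
  \<comment> \<open>\<open>P'\<close> and \<open>Pt\<close> agree on all agents before
    \<open>i\<close>, so \<open>i\<close> faces the same menu at both.\<close>
  have img: "f P' ` {j \<in> N. (j, i) \<in> r} = f Pt ` {j \<in> N. (j, i) \<in> r}"
  proof (rule image_cong)
    fix j assume "j \<in> {j \<in> N. (j, i) \<in> r}"
    then obtain t where t: "t < n" "j = \<sigma> t" "(\<sigma> t, \<sigma> p) \<in> r" using agent_at i by blast
    have "\<not> p < t" using \<sigma>_less[of p t] t linorders_asym[OF r] by blast
    moreover have "t \<noteq> p" using t(3) r by (auto simp: linorders_iff irrefl_def)
    ultimately have "t < p" by simp
    then show "f P' j = f Pt j"
      using serial_determined[OF dom(2,3), of t] agree[OF _ dom(2,3)] codes(2,3) t(1,2) by simp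
  qed simp
  define Y where "Y = insert a0 (A - f P' ` {j \<in> N. (j, i) \<in> r})"
  have Y: "finite Y" "Y \<noteq> {}" "Y \<subseteq> insert a0 A" using A by (auto simp: Y_def)
  have "f P' i = best (P i) Y" using serial[OF dom(2) i(2)] Pi by (simp add: Y_def)
  moreover have "f Pt i = best (Pt i) Y" using serial[OF dom(3) i(2)] img by (simp add: Y_def)
  then have "f Pt i \<in> Y" using best_in[OF pref_in[OF dom(3) i(2)] Y] by simp
  ultimately have "weakly_prefers (P i) (f P' i) (f Pt i)"
    using best_above[OF pref_in[OF dom(1) i(2)] Y, of "f Pt i"] by metis
  then show "weakly_prefers (P i) (induced_rule mech P' i) (induced_rule mech Pt i)"
    using dom by (simp add: induced)
qed

lemma implementable: "SOSP_implementable N A a0 (full_domain A a0) f"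
  unfolding SOSP_implementable_def
  using mechanism SOSP_mech induced by (intro exI[of _ mech]) simp

end

section \<open>Assembling the equivalence\<close>

lemma SOSP_implementable_if_serial_dictatorship:
  assumes "finite N" "finite A"
    and serial: "serial_dictatorship N A a0 (full_domain A a0) f"
    and f: "\<And>P. P \<in> profiles N (full_domain A a0) \<Longrightarrow> f P \<in> allocations N A a0"
  shows "SOSP_implementable N A a0 (full_domain A a0) f"
proof -
  obtain r where r: "r \<in> linorders N" "\<forall>P\<in>profiles N (full_domain A a0). \<forall>i\<in>N.
      f P i = best (P i) (insert a0 (A - f P ` {j \<in> N. (j, i) \<in> r}))"
    using serial unfolding serial_dictatorship_def by blast
  obtain \<sigma> where \<sigma>: "bij_betw \<sigma> {..<card N} N"
    "\<forall>s t. s < t \<and> t < card N \<longrightarrow> (\<sigma> s, \<sigma> t) \<in> r"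
    using enumerate_linorder[OF assms(1) r(1)] by blast
  have "finite (linorders (insert a0 A))" using assms(2) by (simp add: finite_linorders)
  then obtain q m where q: "bij_betw q {..<m::nat} (linorders (insert a0 A))"
    using ex_bij_betw_nat_finite by (metis lessThan_atLeast0)
  interpret revelation N A a0 r f \<sigma> q "card N" m
    using assms(2) r \<sigma> q f by unfold_locales auto
  show ?thesis by (rule implementable)
qed

text \<open>Feasibility is read off the serial dictatorship equation, since nobody is offered an
  object already taken. The revelation mechanism needs it because its leaves must carry
  allocations.\<close>

lemma (in fpttc_market) fpttc_allocations:
  assumes serial: "serial_dictatorship N A a0 (full_domain A a0) (fpttc N A a0 prio)"
    and P: "P \<in> profiles N (full_domain A a0)"
  shows "fpttc N A a0 prio P \<in> allocations N A a0"
proof -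
  let ?\<mu> = "fpttc N A a0 prio P"
  have Pl: "P \<in> N \<rightarrow> prefs" using P by (auto simp: full_domain_def)
  obtain r where r: "r \<in> linorders N"
    "\<And>i. i \<in> N \<Longrightarrow> ?\<mu> i = best (P i) (insert a0 (A - ?\<mu> ` {j \<in> N. (j, i) \<in> r}))"
    using serial P unfolding serial_dictatorship_def by blast
  note props = serial_allocation_props[OF Pl r]
  have "?\<mu> \<in> N \<rightarrow> insert a0 A" using props(1) by blast
  moreover have "?\<mu> \<in> extensional N" using fpttc_extensional[of P] Pl by blast
  moreover have "card {i \<in> N. ?\<mu> i = a} \<le> 1" if "a \<in> A" for a
    using props(3) that by (subst card_le_Suc0_iff_eq[folded One_nat_def]) (auto simp: finN)
  ultimately show ?thesis by (simp add: allocations_def PiE_def)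
qed

theorem theorem5p3:
  fixes n :: nat and N :: "nat set" and A :: "'a set" and a0 :: 'a
    and prio :: "'a \<Rightarrow> nat rel"
  assumes "N = {1..n}"
    and "finite A" and "A \<noteq> {}" and "a0 \<notin> A"
    and "\<forall>a\<in>A. prio a \<in> linorders N"
  shows "SOSP_implementable N A a0 (full_domain A a0) (fpttc N A a0 prio) \<longleftrightarrow>
         serial_dictatorship N A a0 (full_domain A a0) (fpttc N A a0 prio)"
proof -
  interpret fpttc_market N A a0 prio
    using assms by unfold_locales auto
  let ?f = "fpttc N A a0 prio"
  \<comment> \<open>The priority of one fixed object supplies the order of the dictatorship.\<close>
  obtain a where a: "a \<in> A" using assms(3) by blast
  show ?thesis
  proof
    assume "SOSP_implementable N A a0 (full_domain A a0) ?f"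
    then have "prio b = prio a" if "b \<in> A" for b
      using common_priority_if_SOSP_implementable a that by blast
    then show "serial_dictatorship N A a0 (full_domain A a0) ?f"
      by (rule serial_dictatorship_if_common_priority[OF prio[OF a]])
  next
    assume "serial_dictatorship N A a0 (full_domain A a0) ?f"
    then show "SOSP_implementable N A a0 (full_domain A a0) ?f"
      using fpttc_allocations finN finA
      by (intro SOSP_implementable_if_serial_dictatorship) auto
  qed
qed

end
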